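(* Let $\nu\in(0,1)$ and $\lambda>0$. Let $U$ be an exponentially distributed random variable with parameter $\lambda$ (density $\lambda e^{-\lambda y}$, $y>0$), and let $\mathcal{T}_\nu(t)$, $t>0$, be a nonnegative random process, independent of $U$, whose one-dimensional density at time $t$ is $q_\nu(y,t)$, $y>0$. Then the crossing probability $$\psi_\nu(t)=\Pr\{\mathcal{T}_\nu(t)<U\},\qquad t>0,$$ satisfies the fractional relaxation equation $$\frac{d^\nu}{dt^\nu}\psi_\nu(t)=-\lambda\,\psi_\nu(t),\qquad t>0,$$ with initial condition $\psi_\nu(0)=1$.
   Context: For $\nu\in(0,1)$, $\frac{d^\nu}{dt^\nu}$ is the Caputo fractional derivative $$\frac{d^{\nu}}{dt^{\nu}}u(t)=\frac{1}{\Gamma(1-\nu)}\int_0^t\frac{1}{(t-s)^{\nu}}\frac{d}{ds}u(s)\,ds .$$ The density $q_\nu$ is the folded solution of the fractional diffusion equation $\frac{\partial^{2\nu}v}{\partial t^{2\nu}}=\frac{\partial^2 v}{\partial y^2}$, $t>0$, $y\in\mathbb{R}$, $v(y,0)=\delta(y)$ (and $v_t(y,0)=0$ when $2\nu>1$), i.e. $q_\nu(y,t)=2v(y,t)$ for $y\ge 0$ and $q_\nu(y,t)=0$ for $y<0$. Explicitly, $$q_\nu(y,t)=\frac{1}{t^\nu}\mathcal{W}_{-\nu,1-\nu}\left(-\frac{y}{t^\nu}\right),\quad y,t>0,\qquad \mathcal{W}_{\alpha,\beta}(x)=\sum_{j=0}^\infty\frac{x^j}{j!\,\Gamma(\alpha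 j+\beta)}$$ (the Wright function, with $1/\Gamma=0$ at the poles of $\Gamma$). The value at $t=0$ is understood as the limit $t\to0^+$. *)

theory Defs
  imports "HOL-Probability.Probability"
begin

text \<open>The real function \<^const>\<open>rGamma\<close> is the entire reciprocal Gamma function; it vanishes at
  the poles of \<^const>\<open>Gamma\<close>.\<close>

definition wright :: "real \<Rightarrow> real \<Rightarrow> real \<Rightarrow> real" where
  "wright \<alpha> \<beta> x = (\<Sum>j. x ^ j / fact j * rGamma (\<alpha> * real j + \<beta>))"

text \<open>Density in \<open>y\<close> of the folded solution of the fractional diffusion equation of order \<open>2 \<nu>\<close>.
  Only times \<open>t > 0\<close> are meaningful.\<close>

definition folded_diffusion_density :: "real \<Rightarrow> real \<Rightarrow> real \<Rightarrow> real" where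
  "folded_diffusion_density \<nu> y t =
     (if y < 0 then 0 else 1 / t powr \<nu> * wright (- \<nu>) (1 - \<nu>) (- (y / t powr \<nu>)))"

definition caputo_deriv :: "real \<Rightarrow> (real \<Rightarrow> real) \<Rightarrow> real \<Rightarrow> real" where
  "caputo_deriv \<nu> u t =
     1 / Gamma (1 - \<nu>) * (LBINT s:{0<..<t}. 1 / (t - s) powr \<nu> * deriv u s)"

text \<open>Since \<^const>\<open>deriv\<close> and the integral are total, an equation for \<^const>\<open>caputo_deriv\<close> alone
  does not say that the Caputo derivative exists; the following relation adds this.\<close>

definition has_caputo_deriv :: "real \<Rightarrow> (real \<Rightarrow> real) \<Rightarrow> real \<Rightarrow> real \<Rightarrow> bool" where
  "has_caputo_deriv \<nu> u D t \<longleftrightarrow>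
     (\<forall>s\<in>{0<..<t}. u differentiable (at s)) \<and>
     set_integrable lborel {0<..<t} (\<lambda>s. 1 / (t - s) powr \<nu> * deriv u s) \<and>
     caputo_deriv \<nu> u t = D"

definition crossing_prob :: "'a measure \<Rightarrow> (real \<Rightarrow> 'a \<Rightarrow> real) \<Rightarrow> ('a \<Rightarrow> real) \<Rightarrow> real \<Rightarrow> real" where
  "crossing_prob M T U t = measure M {\<omega> \<in> space M. T t \<omega> < U \<omega>}"

end

theory Submission
  imports Defs "HOL-Complex_Analysis.Complex_Analysis" "HOL-Real_Asymp.Real_Asymp"
begin

text \<open>
  The exponential law turns \<open>\<psi>(t)\<close> into the Laplace transform \<open>\<integral> e\<^sup>-\<^sup>l\<^sup>y q(y, t) dy\<close>, which is the
  Mittag-Leffler function \<open>E(- l t\<^sup>\<nu>)\<close>; termwise Beta integrals then give the fractional relaxation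
  equation. To compute the transform, \<open>1 / \<Gamma>\<close> is written as a Hankel integral, over a ray starting at
  \<open>R > 0\<close> with angle \<open>\<theta>\<close> slightly above \<open>\<pi> / 2\<close>. Summing the Wright series under the integral sign
  gives the integrand \<open>e\<^sup>s s\<^sup>\<nu>\<^sup>-\<^sup>1 exp (- y s\<^sup>\<nu>)\<close>, where \<open>Re s\<^sup>\<nu>\<close> is bounded below by a positive number on
  the ray as \<open>\<nu> \<theta> < \<pi> / 2\<close>. Fubini's theorem then gives the integrand \<open>e\<^sup>s s\<^sup>\<nu>\<^sup>-\<^sup>1 / (s\<^sup>\<nu> + l)\<close>, and for
  large \<open>R\<close> a geometric series gives the Mittag-Leffler series.

  The sign of the Wright function need not be studied: \<open>q(\<cdot>, t)\<close> has integral \<open>E(0) = 1\<close>, and so has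
  its positive part, being the density of a random variable. Hence \<open>q \<ge> 0\<close> almost everywhere.
\<close>

section \<open>Improper integrals\<close>

text \<open>Nonnegativity makes the gauge integral absolute, and Borel measurability brings it down
  from the completed measure to \<open>lborel\<close>.\<close>

lemma set_integrable_lborel_nonneg_has_integral:
  fixes f :: "real \<Rightarrow> real"
  assumes "(f has_integral I) S" "\<And>x. x \<in> S \<Longrightarrow> 0 \<le> f x" "set_borel_measurable borel S f"
  shows "set_integrable lborel S f" "(LBINT x:S. f x) = I"
proof -
  have "set_integrable lebesgue S f"
    using assms by (intro nonnegative_absolutely_integrable_1) auto
  thus *: "set_integrable lborel S f"
    using assms(3) unfolding set_integrable_def set_borel_measurable_def
    by (subst (asm) integrable_completion) auto
  show "(LBINT x:S. f x) = I"
    using set_borel_integral_eq_integral(2)[OF *] assms(1) by (simp add: integral_unique)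
qed

lemma set_integrable_exp_neg:
  assumes "0 < (c::real)"
  shows "set_integrable lborel {0..} (\<lambda>x. exp (- c * x))"
proof (rule set_integrable_lborel_nonneg_has_integral)
  show "((\<lambda>x. exp (- c * x)) has_integral exp (- c * 0) / c) {0..}"
    using has_integral_exp_minus_to_infinity[of c 0] assms by simp
qed (auto simp: set_borel_measurable_def)

text \<open>Links Lebesgue integrals over the half-line to gauge integrals over compact intervals,
  where the fundamental theorem of calculus applies.\<close>

lemma tendsto_integral_Icc_at_top:
  fixes f :: "real \<Rightarrow> 'a::euclidean_space"
  assumes "set_integrable lborel {0..} f"
  shows "((\<lambda>y. integral {0..y} f) \<longlongrightarrow> (LBINT x:{0..}. f x)) at_top"
proof (rule Lim_transform_eventually)
  show "((\<lambda>y. LBINT x. indicator {..y} x *\<^sub>R (indicator {0..} x *\<^sub>R f x)) \<longlongrightarrow> (LBINT x:{0..}. f x)) at_top"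
    unfolding set_lebesgue_integral_def using assms
    by (intro tendsto_integral_at_top) (auto simp: set_integrable_def)
  show "\<forall>\<^sub>F y in at_top. (LBINT x. indicator {..y} x *\<^sub>R (indicator {0..} x *\<^sub>R f x)) = integral {0..y} f"
  proof (intro always_eventually allI)
    fix y :: real
    have "set_integrable lborel {0..y} f"
      by (rule set_integrable_subset[OF assms]) auto
    from set_borel_integral_eq_integral(2)[OF this]
    have "(LBINT x:{0..y}. f x) = integral {0..y} f" .
    moreover have "(LBINT x. indicator {..y} x *\<^sub>R (indicator {0..} x *\<^sub>R f x)) = (LBINT x:{0..y}. f x)"
      unfolding set_lebesgue_integral_def
      by (intro Bochner_Integration.integral_cong) (auto simp: indicator_def)
    ultimately show "(LBINT x. indicator {..y} x *\<^sub>R (indicator {0..} x *\<^sub>R f x)) = integral {0..y} f"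
      by simp
  qed
qed

lemma set_integral_FTC_at_top:
  fixes f :: "real \<Rightarrow> 'a::euclidean_space"
  assumes "\<And>x. 0 \<le> x \<Longrightarrow> (F has_vector_derivative f x) (at x within {0..})"
    and "set_integrable lborel {0..} f" and "(F \<longlongrightarrow> L) at_top"
  shows "(LBINT x:{0..}. f x) = L - F 0"
proof -
  have "((\<lambda>y. integral {0..y} f) \<longlongrightarrow> L - F 0) at_top"
  proof (rule Lim_transform_eventually)
    show "((\<lambda>y. F y - F 0) \<longlongrightarrow> L - F 0) at_top"
      by (intro tendsto_intros assms)
    show "\<forall>\<^sub>F y in at_top. F y - F 0 = integral {0..y} f"
      using eventually_ge_at_top[of 0]
    proof eventually_elim
      case (elim y)
      have "(f has_integral F y - F 0) {0..y}"
        using elim assms(1)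
        by (intro fundamental_theorem_of_calculus has_vector_derivative_within_subset[OF assms(1)]) auto
      thus ?case by (simp add: integral_unique)
    qed
  qed
  thus ?thesis
    using tendsto_integral_Icc_at_top[OF assms(2)] tendsto_unique trivial_limit_at_top_linorder by blast
qed

text \<open>The limit form in which \<open>Gamma\<close> enters once the contour lies along the
  negative real axis.\<close>

lemma Gamma_integral_real_tendsto:
  assumes "0 < (a::real)"
  shows "((\<lambda>X. integral {0..X} (\<lambda>r. r powr a / exp r)) \<longlongrightarrow> Gamma (a + 1)) at_top"
proof -
  have "((\<lambda>r. r powr a / exp r) has_integral Gamma (a + 1)) {0..}"
    using Gamma_integral_real[of "a + 1"] assms by simp
  hence "set_integrable lborel {0..} (\<lambda>r. r powr a / exp r)"
        "(LBINT r:{0..}. r powr a / exp r) = Gamma (a + 1)"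
    by (auto intro!: set_integrable_lborel_nonneg_has_integral simp: set_borel_measurable_def)
  thus ?thesis using tendsto_integral_Icc_at_top by metis
qed

text \<open>Serves to dominate the partial sums of the Wright series on the ray uniformly in
  \<open>n\<close>.\<close>

lemma sum_exp_series_le:
  fixes x :: real
  assumes "0 \<le> x"
  shows "(\<Sum>j<n. x ^ j / fact j) \<le> exp x"
proof -
  have "(\<lambda>j. x ^ j / fact j) sums exp x"
    using exp_converges[of x] by (simp add: field_simps)
  thus ?thesis
    using sum_le_suminf[of "\<lambda>j. x ^ j / fact j" "{..<n}"] assms
    by (simp add: sums_iff)
qed

text \<open>The primitive \<open>- exp (- c * y) / c\<close> vanishes at infinity because
  \<open>Re c\<close> is positive. This is the inner integral in \<open>y\<close> after
  Fubini.\<close>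

lemma laplace_one_complex:
  assumes "0 < Re c"
  shows "set_integrable lborel {0..} (\<lambda>y. exp (- c * of_real y))"
    and "(LBINT y:{0..}. exp (- c * of_real y)) = 1 / c"
proof -
  show int: "set_integrable lborel {0..} (\<lambda>y. exp (- c * of_real y))"
  proof (rule set_integrable_bound[OF set_integrable_exp_neg[OF assms]])
    have "continuous_on {0..} (\<lambda>y. exp (- c * of_real y))"
      by (intro continuous_intros)
    thus "set_borel_measurable lborel {0..} (\<lambda>y. exp (- c * of_real y))"
      unfolding set_borel_measurable_def by (simp add: borel_measurable_continuous_on_indicator)
  qed (auto simp: norm_exp_eq_Re)
  have "(LBINT y:{0..}. exp (- c * of_real y)) = 0 - (- exp (- c * of_real 0) / c)"
  proof (rule set_integral_FTC_at_top[OF _ int])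
    show "((\<lambda>y. - exp (- c * of_real y) / c) has_vector_derivative exp (- c * of_real y)) (at y within {0..})"
      for y :: real
    proof -
      have "((\<lambda>z. - exp (- c * z) / c) has_field_derivative exp (- c * of_real y)) (at (of_real y))"
        using assms by (auto intro!: derivative_eq_intros)
      from has_vector_derivative_real_field[OF this] show ?thesis .
    qed
    have "((\<lambda>y. exp (- a * y)) \<longlongrightarrow> 0) at_top" if "0 < a" for a :: real
      using that by real_asymp
    from tendsto_divide_zero[OF this[OF assms], of "norm c"]
    have "((\<lambda>y. norm (- exp (- c * of_real y) / c)) \<longlongrightarrow> 0) at_top"
      by (simp add: norm_divide norm_exp_eq_Re)
    thus "((\<lambda>y. - exp (- c * of_real y) / c) \<longlongrightarrow> 0) at_top"
      by (rule tendsto_norm_zero_cancel)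
  qed
  thus "(LBINT y:{0..}. exp (- c * of_real y)) = 1 / c" by simp
qed

text \<open>Supplies the product majorant for Fubini's theorem.\<close>

lemma integrable_lborel_prod:
  fixes u v :: "real \<Rightarrow> real"
  assumes "integrable lborel u" "integrable lborel v"
  shows "integrable (lborel \<Otimes>\<^sub>M lborel) (\<lambda>(x, y). u x * v y)"
proof (rule lborel_pair.Fubini_integrable)
  have [measurable]: "u \<in> borel_measurable lborel" "v \<in> borel_measurable lborel"
    using assms by auto
  show "(\<lambda>(x, y). u x * v y) \<in> borel_measurable (lborel \<Otimes>\<^sub>M lborel)"
    by measurable
  show "integrable lborel (\<lambda>x. LBINT y. norm (case (x, y) of (x, y) \<Rightarrow> u x * v y))"
    using assms by (simp add: abs_mult)
qed (use assms in simp)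

section \<open>Hankel integrals along a ray\<close>

text \<open>The rotated branch \<open>Ln (- \<i> s)\<close> is analytic across the negative real axis.\<close>

lemma powr_rotate_upper:
  assumes "0 \<le> Im s" "s \<noteq> 0"
  shows "s powr z = (- \<i> * s) powr z * exp (z * (\<i> * pi / 2))"
proof -
  have "0 \<le> Im (Ln s)" "Im (Ln s) \<le> pi"
    using assms Arg_less_0[of s] Arg_le_pi[of s] by (auto simp: Arg_eq_Im_Ln)
  \<comment> \<open>The argument of \<open>s\<close> lies between 0 and pi, so subtracting pi/2
    stays within the principal range and no multiple of 2 pi i appears.\<close>
  hence "Ln (- \<i> * s) = Ln (- \<i>) + Ln s"
    using assms pi_gt_zero by (intro Ln_times_simple) (simp_all, (use pi_gt_zero in linarith)+)
  hence "Ln s = Ln (- \<i> * s) + \<i> * pi / 2" by simp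
  hence "exp (z * Ln s) = exp (z * Ln (- \<i> * s)) * exp (z * (\<i> * pi / 2))"
    by (simp only: distrib_left exp_add)
  thus ?thesis
    using assms by (simp add: powr_def)
qed

text \<open>The rotated point \<open>- \<i> * s\<close> has real part \<open>Im s \<ge> 0\<close>,
  so it meets the branch cut at most in the origin, where \<open>a > 0\<close> ensures
  continuity.\<close>

lemma continuous_on_powr_upper:
  assumes "0 < (a::real)"
  shows "continuous_on {s. 0 \<le> Im s} (\<lambda>s. s powr of_real a)"
proof (rule continuous_on_eq)
  show "continuous_on {s. 0 \<le> Im s} (\<lambda>s. (- \<i> * s) powr of_real a * exp (of_real a * (\<i> * pi / 2)))"
    using assms by (intro continuous_intros) auto
  show "(- \<i> * s) powr of_real a * exp (of_real a * (\<i> * pi / 2)) = s powr of_real a"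
    if "s \<in> {s. 0 \<le> Im s}" for s
    using that powr_rotate_upper[of s "of_real a"] by (cases "s = 0") auto
qed

text \<open>The integrand is holomorphic in the open half-plane and continuous up to its boundary,
  which suffices for a primitive on the closed convex set. Contours may thus be pushed onto the cut
  itself.\<close>

lemma exp_powr_primitive_upper:
  assumes "0 < (a::real)"
  obtains G where "\<And>s. 0 \<le> Im s \<Longrightarrow>
    (G has_field_derivative exp s * s powr of_real a) (at s within {s. 0 \<le> Im s})"
proof (rule holomorphic_convex_primitive[of "{s. 0 \<le> Im s}" "{}" "\<lambda>s. exp s * s powr of_real a"])
  show "convex {s. 0 \<le> Im s}" by (rule convex_halfspace_Im_ge)
  show "continuous_on {s. 0 \<le> Im s} (\<lambda>s. exp s * s powr of_real a)"
    by (intro continuous_intros continuous_on_powr_upper assms)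
  show "(\<lambda>s. exp s * s powr of_real a) field_differentiable at x"
    if "x \<in> interior {s. 0 \<le> Im s} - {}" for x
  proof -
    have "interior {s. 0 \<le> Im s} = {s. 0 < Im s}"
      using interior_halfspace_ge[of \<i> 0] by simp
    hence "x \<notin> \<real>\<^sub>\<le>\<^sub>0" using that by (auto simp: complex_nonpos_Reals_iff)
    thus ?thesis
      by (intro field_differentiable_mult field_differentiable_within_exp)
         (auto simp: field_differentiable_def intro!: has_field_derivative_powr)
  qed
qed (use that in auto)

lemma powr_sublinear:
  fixes \<nu> \<epsilon> y :: real
  assumes \<nu>: "0 < \<nu>" "\<nu> < 1" and "0 < \<epsilon>" "0 \<le> y"
  obtains C where "\<And>x. 0 < x \<Longrightarrow> y * x powr \<nu> \<le> \<epsilon> * x + C"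
proof -
  \<comment> \<open>Up to \<open>X\<close> the left side is at most \<open>y * X powr \<nu>\<close>;
    beyond \<open>X\<close> the linear term alone wins. Taking \<open>y + 1\<close> instead of
    \<open>y\<close> keeps \<open>X\<close> positive for \<open>y = 0\<close>.\<close>
  define X where "X = ((y + 1) / \<epsilon>) powr (1 / (1 - \<nu>))"
  have X: "X > 0" "X powr (1 - \<nu>) = (y + 1) / \<epsilon>"
    using assms by (auto simp: X_def powr_powr)
  have "y * x powr \<nu> \<le> \<epsilon> * x + y * X powr \<nu>" if x: "0 < x" for x
  proof (cases "x \<le> X")
    case True
    have "y * x powr \<nu> \<le> y * X powr \<nu>"
      using assms True x by (intro mult_left_mono powr_mono2) auto
    also have "\<dots> \<le> \<epsilon> * x + y * X powr \<nu>"
      using x assms by simp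
    finally show ?thesis .
  next
    case False
    have "y \<le> \<epsilon> * X powr (1 - \<nu>)"
      using assms X by simp
    also have "\<dots> \<le> \<epsilon> * x powr (1 - \<nu>)"
      using assms False X by (intro mult_left_mono powr_mono2) auto
    finally have "y * x powr \<nu> \<le> \<epsilon> * x powr (1 - \<nu>) * x powr \<nu>"
      by (intro mult_right_mono) auto
    also have "\<dots> = \<epsilon> * x"
      using x by (simp add: mult.assoc flip: powr_add)
    also have "\<dots> \<le> \<epsilon> * x + y * X powr \<nu>"
      using assms by simp
    finally show ?thesis .
  qed
  thus ?thesis by (rule that)
qed

text \<open>The range of \<open>\<theta>\<close> makes \<open>exp\<close> decay along the ray. The
  number \<open>R * sin \<theta>\<close> is the distance from the origin to the line carrying the
  ray, so all moduli on the ray are at least 1.\<close>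

locale hankel_ray =
  fixes R \<theta> :: real
  assumes \<theta>: "pi / 2 < \<theta>" "\<theta> < pi" and R: "1 \<le> R * sin \<theta>"
begin

definition ray :: "real \<Rightarrow> complex" where
  "ray p = of_real R + of_real p * cis \<theta>"

text \<open>The factor \<open>cis \<theta>\<close> is the velocity of \<open>ray\<close>, so
  integrating \<open>kernel p * h (ray p)\<close> in \<open>p\<close> is the contour integral of
  exp(s) h(s).\<close>

definition kernel :: "real \<Rightarrow> complex" where
  "kernel p = cis \<theta> * exp (ray p)"

text \<open>For \<open>h\<close> commuting with complex conjugation this is the integral of \<open>e\<^sup>s h(s) / (2 \<pi> \<i>)\<close> over the
  Hankel contour formed by the ray and its mirror image, which contributes the conjugate value.\<close>

definition hankel :: "(complex \<Rightarrow> complex) \<Rightarrow> real" where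
  "hankel h = Im (LBINT p:{0..}. kernel p * h (ray p)) / pi"

section \<open>Geometry of the ray\<close>

lemma sin_pos: "sin \<theta> > 0" and cos_neg: "cos \<theta> < 0"
proof -
  show "sin \<theta> > 0" using \<theta> by (intro sin_gt_zero) auto
  have "cos (pi - \<theta>) > 0" using \<theta> by (intro cos_gt_zero_pi) auto
  thus "cos \<theta> < 0" by simp
qed

lemma R_pos: "R > 0"
  using R sin_pos by (metis less_le_trans zero_less_mult_pos2 zero_less_one)

lemma Re_ray: "Re (ray p) = R + p * cos \<theta>" and Im_ray: "Im (ray p) = p * sin \<theta>"
  by (auto simp: ray_def)

lemma ray_0 [simp]: "ray 0 = of_real R"
  by (simp add: ray_def)

text \<open>Rotation by \<open>- \<theta>\<close> makes the ray horizontal, at height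
  \<open>- R * sin \<theta>\<close>.\<close>

lemma norm_ray_ge: "norm (ray p) \<ge> R * sin \<theta>"
proof -
  have "Im (ray p * cis (- \<theta>)) = - R * sin \<theta>"
    by (simp add: ray_def algebra_simps cis_mult)
  thus ?thesis
    using abs_Im_le_cmod[of "ray p * cis (- \<theta>)"] R by (simp add: norm_mult)
qed

lemma norm_ray_ge_1: "norm (ray p) \<ge> 1"
  using norm_ray_ge[of p] R by simp

lemma norm_ray_le: "p \<ge> 0 \<Longrightarrow> norm (ray p) \<le> R + p"
  unfolding ray_def using R_pos by (intro order.trans[OF norm_triangle_ineq]) (auto simp: norm_mult)

lemma ray_not_nonpos: "p \<ge> 0 \<Longrightarrow> ray p \<notin> \<real>\<^sub>\<le>\<^sub>0"
  using sin_pos R_pos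
  by (auto simp: complex_nonpos_Reals_iff Re_ray Im_ray mult_le_0_iff)

lemma ray_nonzero [simp]: "ray p \<noteq> 0"
  using norm_ray_ge_1[of p] by auto

text \<open>An argument in [\<theta>, pi] would give the point rotated by \<open>- \<theta>\<close>
  a nonnegative imaginary part, but that part is \<open>- R * sin \<theta> < 0\<close>.\<close>

lemma Arg_ray:
  assumes "p \<ge> 0"
  shows "0 \<le> Arg (ray p)" "Arg (ray p) < \<theta>"
proof -
  show 0: "0 \<le> Arg (ray p)"
    using assms sin_pos by (subst Arg_less_0 ) (auto simp: Im_ray)
  show "Arg (ray p) < \<theta>"
  proof (rule ccontr)
    assume "\<not> Arg (ray p) < \<theta>"
    hence "0 \<le> sin (Arg (ray p) - \<theta>)"
      using Arg_le_pi[of "ray p"] \<theta> by (intro sin_ge_zero) auto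
    moreover have "Im (ray p * cis (- \<theta>)) = - R * sin \<theta>"
      by (simp add: ray_def algebra_simps cis_mult)
    moreover have "ray p * cis (- \<theta>) = of_real (norm (ray p)) * cis (Arg (ray p) - \<theta>)"
      using rcis_cmod_Arg[of "ray p"] cis_mult[of "Arg (ray p)" "- \<theta>"]
      by (simp add: rcis_def) (metis mult.assoc)
    ultimately have "norm (ray p) * sin (Arg (ray p) - \<theta>) = - R * sin \<theta>"
      by simp
    with \<open>0 \<le> sin (Arg (ray p) - \<theta>)\<close> show False
      using R mult_nonneg_nonneg[OF norm_ge_zero[of "ray p"]] by fastforce
  qed
qed

text \<open>The power has modulus at least 1 and argument between 0 and
  \<open>\<nu> * \<theta> < pi / 2\<close>. The bound is uniform in \<open>p\<close>, as the Laplace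
  integral in \<open>y\<close> requires.\<close>

lemma Re_ray_powr_pos:
  assumes "p \<ge> 0" "0 < \<nu>" "\<nu> * \<theta> < pi / 2"
  shows "Re (ray p powr of_real \<nu>) \<ge> cos (\<nu> * \<theta>)" "cos (\<nu> * \<theta>) > 0"
proof -
  show pos: "cos (\<nu> * \<theta>) > 0"
    using assms \<theta> mult_pos_pos[of \<nu> \<theta>] pi_gt_zero by (intro cos_gt_zero_pi) linarith+
  have A: "0 \<le> \<nu> * Arg (ray p)" "\<nu> * Arg (ray p) \<le> \<nu> * \<theta>"
    using Arg_ray[OF assms(1)] assms by auto
  have "Re (ray p powr of_real \<nu>) = norm (ray p) powr \<nu> * cos (\<nu> * Arg (ray p))"
    by (simp add: powr_def Re_exp Arg_eq_Im_Ln)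
  also have "\<dots> \<ge> 1 * cos (\<nu> * \<theta>)"
  proof (rule mult_mono)
    show "cos (\<nu> * \<theta>) \<le> cos (\<nu> * Arg (ray p))"
      using A assms(3) pi_gt_zero by (intro cos_monotone_0_pi_le) linarith+
  qed (use assms pos norm_ray_ge_1[of p] in \<open>auto intro!: ge_one_powr_ge_zero\<close>)
  finally show "Re (ray p powr of_real \<nu>) \<ge> cos (\<nu> * \<theta>)" by simp
qed

lemma continuous_ray [continuous_intros]: "continuous_on A ray"
  unfolding ray_def by (intro continuous_intros)

lemma continuous_kernel [continuous_intros]: "continuous_on A kernel"
  unfolding kernel_def by (intro continuous_intros)

lemma continuous_ray_powr [continuous_intros]:
  "continuous_on {0..} (\<lambda>p. ray p powr of_real z)"
  by (intro continuous_on_powr_complex continuous_intros) (use ray_not_nonpos in \<open>auto simp: complex_nonpos_Reals_iff\<close>)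

section \<open>Decay and integrability of the kernel\<close>

lemma norm_ray_powr: "norm (ray p powr of_real z) = norm (ray p) powr z"
  by (simp add: norm_powr_real_powr')

lemma norm_kernel: "norm (kernel p) = exp (R + p * cos \<theta>)"
  by (simp add: kernel_def norm_mult Re_ray)

text \<open>Since \<open>ln r \<le> r powr \<nu> / \<nu>\<close>, the power and the last exponential
  together contribute an exponent of order \<open>r powr \<nu>\<close>. This is sublinear in
  \<open>p\<close>, so half of the decay \<open>exp (p * cos \<theta>)\<close> absorbs it.\<close>

lemma kernel_bound:
  assumes "0 < \<nu>" "\<nu> < 1"
  obtains C where "\<And>p. p \<ge> 0 \<Longrightarrow>
    norm (kernel p) * norm (ray p) powr a * exp (y * norm (ray p) powr \<nu>) \<le> C * exp (p * (cos \<theta> / 2))"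
proof -
  obtain C where C: "\<And>x. 0 < x \<Longrightarrow> (\<bar>a\<bar> / \<nu> + \<bar>y\<bar>) * x powr \<nu> \<le> (- cos \<theta> / 2) * x + C"
    using powr_sublinear[of \<nu> "- cos \<theta> / 2" "\<bar>a\<bar> / \<nu> + \<bar>y\<bar>"] assms cos_neg
    by (metis abs_ge_zero add_nonneg_nonneg divide_nonneg_pos half_gt_zero neg_0_less_iff_less)
  have "norm (kernel p) * norm (ray p) powr a * exp (y * norm (ray p) powr \<nu>)
      \<le> exp (R - cos \<theta> / 2 * R + C) * exp (p * (cos \<theta> / 2))" if p: "p \<ge> 0" for p
  proof -
    let ?r = "norm (ray p)"
    have r: "?r \<ge> 1" by (rule norm_ray_ge_1)
    have "a * ln ?r \<le> \<bar>a\<bar> * (?r powr \<nu> / \<nu>)"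
      using ln_powr_bound[OF r assms(1)] r by (intro mult_mono) auto
    moreover have "y * ?r powr \<nu> \<le> \<bar>y\<bar> * ?r powr \<nu>"
      by (intro mult_right_mono) auto
    moreover have "(\<bar>a\<bar> / \<nu> + \<bar>y\<bar>) * ?r powr \<nu> = \<bar>a\<bar> * (?r powr \<nu> / \<nu>) + \<bar>y\<bar> * ?r powr \<nu>"
      by (simp add: algebra_simps)
    ultimately have "a * ln ?r + y * ?r powr \<nu> \<le> (\<bar>a\<bar> / \<nu> + \<bar>y\<bar>) * ?r powr \<nu>"
      by linarith
    also have "\<dots> \<le> (- cos \<theta> / 2) * ?r + C"
      using r by (intro C) linarith
    also have "\<dots> \<le> (- cos \<theta> / 2) * (R + p) + C"
      using norm_ray_le[OF p] cos_neg by (intro add_right_mono mult_left_mono) auto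
    also have "(- cos \<theta> / 2) * (R + p) + C = - cos \<theta> / 2 * R + C - p * (cos \<theta> / 2)"
      by (simp add: algebra_simps add_divide_distrib)
    finally have "exp (R + p * cos \<theta> + a * ln ?r + y * ?r powr \<nu>)
        \<le> exp (R - cos \<theta> / 2 * R + C + p * (cos \<theta> / 2))"
      by simp
    moreover have "norm (kernel p) * ?r powr a * exp (y * ?r powr \<nu>)
        = exp (R + p * cos \<theta> + a * ln ?r + y * ?r powr \<nu>)"
      using r by (simp add: norm_kernel powr_def exp_add)
    ultimately show ?thesis by (simp add: exp_add mult_ac)
  qed
  thus ?thesis by (rule that)
qed

lemma integrable_exp_decay: "set_integrable lborel {0..} (\<lambda>p. C * exp (p * (cos \<theta> / 2)))"
  using set_integrable_mult_right[OF set_integrable_exp_neg[of "- cos \<theta> / 2"], of C] cos_neg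
  by (simp add: mult.commute)

lemma kernel_integrable:
  assumes "0 < \<nu>" "\<nu> < 1" "continuous_on {0..} g"
    and "\<And>p. p \<ge> 0 \<Longrightarrow> norm (g p) \<le> B * (norm (ray p) powr a * exp (y * norm (ray p) powr \<nu>))"
  shows "set_integrable lborel {0..} (\<lambda>p. kernel p * g p)"
proof -
  obtain C where C: "\<And>p. p \<ge> 0 \<Longrightarrow>
    norm (kernel p) * norm (ray p) powr a * exp (y * norm (ray p) powr \<nu>) \<le> C * exp (p * (cos \<theta> / 2))"
    using kernel_bound[OF assms(1,2)] by blast
  have "norm (g p) \<le> \<bar>B\<bar> * (norm (ray p) powr a * exp (y * norm (ray p) powr \<nu>))" if "p \<ge> 0" for p
    by (rule order.trans[OF assms(4)[OF that]]) (intro mult_right_mono, auto)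
  note g = this
  have "norm (kernel p * g p) \<le> norm (\<bar>B\<bar> * (C * exp (p * (cos \<theta> / 2))))" if "p \<ge> 0" for p
  proof -
    have "norm (kernel p * g p) \<le> norm (kernel p) * (\<bar>B\<bar> * (norm (ray p) powr a * exp (y * norm (ray p) powr \<nu>)))"
      unfolding norm_mult using g[OF that] by (intro mult_left_mono) auto
    also have "\<dots> = \<bar>B\<bar> * (norm (kernel p) * norm (ray p) powr a * exp (y * norm (ray p) powr \<nu>))"
      by simp
    also have "\<dots> \<le> \<bar>B\<bar> * (C * exp (p * (cos \<theta> / 2)))"
      using C[OF that] by (intro mult_left_mono) auto
    finally show ?thesis
      unfolding real_norm_def by (rule order.trans[OF _ abs_ge_self])
  qed
  note bound = this
  show ?thesis
  proof (rule set_integrable_bound)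
    show "set_integrable lborel {0..} (\<lambda>p. \<bar>B\<bar> * (C * exp (p * (cos \<theta> / 2))))"
      by (intro set_integrable_mult_right integrable_exp_decay)
    have "continuous_on {0..} (\<lambda>p. kernel p * g p)"
      by (intro continuous_on_mult continuous_kernel assms)
    thus "set_borel_measurable lborel {0..} (\<lambda>p. kernel p * g p)"
      unfolding set_borel_measurable_def by (simp add: borel_measurable_continuous_on_indicator)
  qed (use bound in auto)
qed

lemma kernel_powr_integrable: "set_integrable lborel {0..} (\<lambda>p. kernel p * ray p powr of_real z)"
proof (rule kernel_integrable)
  show "norm (ray p powr of_real z) \<le> 1 * (norm (ray p) powr z * exp (0 * norm (ray p) powr (1 / 2)))" for p
    by (simp add: norm_ray_powr)
qed (simp_all add: continuous_ray_powr)

text \<open>Makes the contributions from the far end of the ray vanish.\<close>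

lemma kernel_decay:
  "((\<lambda>p. norm (kernel p) * norm (ray p) powr a) \<longlongrightarrow> 0) at_top"
proof -
  obtain C where C: "\<And>p. p \<ge> 0 \<Longrightarrow>
    norm (kernel p) * norm (ray p) powr a * exp (0 * norm (ray p) powr (1/2)) \<le> C * exp (p * (cos \<theta> / 2))"
    using kernel_bound[of "1/2" a 0] by auto
  have "((\<lambda>p. C * exp (p * (cos \<theta> / 2))) \<longlongrightarrow> C * 0) at_top"
    using cos_neg by real_asymp
  hence "((\<lambda>p. C * exp (p * (cos \<theta> / 2))) \<longlongrightarrow> 0) at_top" by simp
  moreover have "\<forall>\<^sub>F p in at_top. norm (norm (kernel p) * norm (ray p) powr a) \<le> C * exp (p * (cos \<theta> / 2))"
    using eventually_ge_at_top[of 0] by eventually_elim (use C in auto)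
  ultimately show ?thesis
    by (rule Lim_null_comparison[rotated])
qed

section \<open>Hankel's formula for positive powers\<close>

lemma ray_has_vector_derivative: "(ray has_vector_derivative cis \<theta>) (at p within A)"
  unfolding ray_def by (auto intro!: derivative_eq_intros)

text \<open>A primitive on the upper half-plane moves the ray to the negative real axis, where \<open>\<Gamma>(a + 1)\<close>
  appears together with the reflection factor \<open>sin (\<pi> a)\<close>; on the positive axis the integrand is real.\<close>

lemma hankel_powr_pos:
  assumes a: "0 < (a::real)"
  shows "hankel (\<lambda>s. s powr of_real a) = rGamma (- a)"
proof -
  obtain G where G: "\<And>s. 0 \<le> Im s \<Longrightarrow>
      (G has_field_derivative exp s * s powr of_real a) (at s within {s. 0 \<le> Im s})"
    using exp_powr_primitive_upper[OF a] by blast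
  \<comment> \<open>Increments of \<open>G\<close> along paths of constant velocity; used for both
    halves of the real axis and for the ray.\<close>
  have G_path: "((\<lambda>x. f' * (exp (f x) * f x powr of_real a)) has_integral G (f v) - G (f u)) {u..v}"
    if "u \<le> v" "\<And>x. x \<in> {u..v} \<Longrightarrow> 0 \<le> Im (f x)"
       "\<And>x. (f has_vector_derivative f') (at x within {u..v})" for f f' u v
  proof -
    have "((G \<circ> f) has_vector_derivative f' * (exp (f x) * f x powr of_real a)) (at x within {u..v})"
      if "x \<in> {u..v}" for x
      using that \<open>\<And>x. x \<in> {u..v} \<Longrightarrow> 0 \<le> Im (f x)\<close>
      by (intro field_vector_diff_chain_within \<open>\<And>x. (f has_vector_derivative f') _\<close>
            has_field_derivative_subset[OF G]) auto
    from fundamental_theorem_of_calculus[OF \<open>u \<le> v\<close> this] show ?thesis by simp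
  qed
  \<comment> \<open>The point \<open>- X P\<close> is the vertical projection of
    \<open>ray P\<close> to the real axis.\<close>
  define X where "X P = - (R + P * cos \<theta>)" for P
  have Im_G_pos: "Im (G (of_real R)) = Im (G 0)"
  proof -
    have "((of_real :: real \<Rightarrow> complex) has_vector_derivative 1) (at x within {0..R})" for x
      using has_vector_derivative_of_real[OF DERIV_ident] by simp
    hence "((\<lambda>x. exp (of_real x) * of_real x powr of_real a) has_integral G (of_real R) - G 0) {0..R}"
      using G_path[of 0 R of_real 1] R_pos by simp
    from has_integral_linear[OF this bounded_linear_Im]
    have "((\<lambda>x. Im (exp (of_real x) * of_real x powr of_real a)) has_integral Im (G (of_real R) - G 0)) {0..R}"
      by (simp add: o_def)
    moreover have "Im (exp (of_real x) * of_real x powr of_real a) = 0" if "x \<in> {0..R}" for x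
      using that by (simp add: powr_of_real Im_exp)
    ultimately have "((\<lambda>x. 0) has_integral Im (G (of_real R) - G 0)) {0..R}"
      using has_integral_eq by (metis (no_types, lifting))
    thus ?thesis by (metis has_integral_0_eq minus_complex.simps(2) eq_iff_diff_eq_0)
  qed
  \<comment> \<open>On the cut the argument is pi, so the power of \<open>- x\<close> is
    \<open>x powr a\<close> times exp(i pi a). The minus sign comes from travelling to the
    left.\<close>
  have Im_G_neg: "Im (G (- of_real Y)) - Im (G 0) = - sin (pi * a) * integral {0..Y} (\<lambda>r. r powr a / exp r)"
    if "0 \<le> Y" for Y
  proof -
    have "((\<lambda>x. - of_real x :: complex) has_vector_derivative - 1) (at x within {0..Y})" for x
      using has_vector_derivative_minus[OF has_vector_derivative_of_real[OF DERIV_ident]] by simp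
    hence "((\<lambda>x. - (exp (- of_real x) * (- of_real x) powr of_real a)) has_integral G (- of_real Y) - G 0) {0..Y}"
      using G_path[of 0 Y "\<lambda>x. - of_real x" "-1"] that by simp
    from has_integral_linear[OF this bounded_linear_Im]
    have "((\<lambda>x. Im (- (exp (- of_real x) * (- of_real x) powr of_real a))) has_integral
        Im (G (- of_real Y) - G 0)) {0..Y}"
      by (simp add: o_def)
    moreover have "Im (- (exp (- of_real x) * (- of_real x) powr of_real a))
        = - sin (pi * a) * (x powr a / exp x)" if "x \<in> {0..Y}" for x
    proof (cases "x = 0")
      case False
      hence x: "x > 0" using that by auto
      have "(- of_real x :: complex) powr of_real a = exp (of_real (a * ln x) + \<i> * of_real (pi * a))"
        using x Ln_minus[of "of_real x"] by (simp add: powr_def Ln_of_real algebra_simps)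
      hence "Im ((- of_real x :: complex) powr of_real a) = x powr a * sin (pi * a)"
        "exp (- of_real x) = complex_of_real (exp (- x))"
        using x by (simp_all add: Im_exp powr_def exp_of_real flip: of_real_minus)
      thus ?thesis by (simp add: exp_minus field_simps)
    qed simp
    ultimately have "((\<lambda>x. - sin (pi * a) * (x powr a / exp x)) has_integral
        Im (G (- of_real Y) - G 0)) {0..Y}"
      using has_integral_eq by (metis (no_types, lifting))
    from integral_unique[OF this]
    have "- sin (pi * a) * integral {0..Y} (\<lambda>r. r powr a / exp r) = Im (G (- of_real Y) - G 0)"
      by (simp only: integral_mult_right)
    thus ?thesis by simp
  qed
  have step: "norm (G (ray P) - G (- of_real (X P))) \<le> norm (kernel P) * norm (ray P) powr (a + 1)"
    if P: "0 \<le> P" for P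
  proof -
    \<comment> \<open>\<open>T\<close> is the vertical segment from \<open>- X P\<close> up to
      \<open>ray P\<close>, written with half-planes to make it convex. Both the modulus of the
      power on \<open>T\<close> and the length of \<open>T\<close> are controlled by
      \<open>norm (ray P)\<close>.\<close>
    define T where "T = {z. Re z \<le> - X P} \<inter> {z. Re z \<ge> - X P} \<inter> {z. Im z \<ge> 0} \<inter> {z. Im z \<le> P * sin \<theta>}"
    have "convex T" unfolding T_def
      by (intro convex_Int convex_halfspace_Im_ge convex_halfspace_Im_le
            convex_halfspace_Re_ge convex_halfspace_Re_le)
    hence "norm (G (ray P) - G (- of_real (X P)))
        \<le> (norm (kernel P) * norm (ray P) powr a) * norm (ray P - (- of_real (X P)))"
    proof (rule field_differentiable_bound)
      fix z assume z: "z \<in> T"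
      show "(G has_field_derivative exp z * z powr of_real a) (at z within T)"
        using z by (intro has_field_derivative_subset[OF G]) (auto simp: T_def)
      have "Re z = Re (ray P)" "\<bar>Im z\<bar> \<le> \<bar>Im (ray P)\<bar>"
        using z by (auto simp: T_def X_def Re_ray Im_ray)
      hence "norm z \<le> norm (ray P)"
        unfolding cmod_def by (intro real_sqrt_le_mono add_mono) (auto simp: abs_le_square_iff)
      moreover have "norm (exp z) = norm (kernel P)"
        using \<open>Re z = _\<close> by (simp add: norm_kernel Re_ray)
      ultimately show "norm (exp z * z powr of_real a) \<le> norm (kernel P) * norm (ray P) powr a"
        using a by (auto simp: norm_mult norm_powr_real_powr' intro!: mult_left_mono powr_mono2)
    qed (use P sin_pos in \<open>auto simp: T_def X_def Re_ray Im_ray\<close>)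
    also have "norm (ray P - (- of_real (X P))) \<le> norm (ray P)"
      using P sin_pos by (simp add: cmod_def X_def Re_ray Im_ray)
    finally show ?thesis
      by (simp add: powr_add mult_left_mono mult.assoc)
  qed
  have X_at_top: "filterlim X at_top at_top"
    unfolding X_def using cos_neg by real_asymp
  have "((\<lambda>P. Im (integral {0..P} (\<lambda>p. kernel p * ray p powr of_real a)))
      \<longlongrightarrow> - sin (pi * a) * Gamma (a + 1) + 0) at_top"
  proof (rule Lim_transform_eventually)
    have "((\<lambda>P. G (ray P) - G (- of_real (X P))) \<longlongrightarrow> 0) at_top"
      by (rule Lim_null_comparison[OF eventually_mono[OF eventually_ge_at_top[of 0] step] kernel_decay])
    hence "((\<lambda>P. Im (G (ray P) - G (- of_real (X P)))) \<longlongrightarrow> 0) at_top"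
      using tendsto_Im by fastforce
    thus "((\<lambda>P. - sin (pi * a) * integral {0..X P} (\<lambda>r. r powr a / exp r)
          + Im (G (ray P) - G (- of_real (X P)))) \<longlongrightarrow> - sin (pi * a) * Gamma (a + 1) + 0) at_top"
      by (intro tendsto_intros filterlim_compose[OF Gamma_integral_real_tendsto[OF a] X_at_top])
    show "\<forall>\<^sub>F P in at_top. - sin (pi * a) * integral {0..X P} (\<lambda>r. r powr a / exp r)
          + Im (G (ray P) - G (- of_real (X P)))
        = Im (integral {0..P} (\<lambda>p. kernel p * ray p powr of_real a))"
      using eventually_ge_at_top[of 0] filterlim_at_top[THEN iffD1, OF X_at_top, rule_format, of 0]
    proof eventually_elim
      case (elim P)
      \<comment> \<open>The path from \<open>R\<close> to \<open>ray P\<close> is replaced by the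
        legs \<open>R\<close> to 0, 0 to \<open>- X P\<close> and the vertical segment. The first
        has no imaginary part and the last vanishes in the limit.\<close>
      have "integral {0..P} (\<lambda>p. kernel p * ray p powr of_real a) = G (ray P) - G (of_real R)"
        using G_path[of 0 P ray "cis \<theta>"] elim sin_pos ray_has_vector_derivative
        by (intro integral_unique) (auto simp: kernel_def Im_ray mult.assoc)
      thus ?case using Im_G_neg[of "X P"] Im_G_pos elim by simp
    qed
  qed
  moreover have "((\<lambda>P. Im (integral {0..P} (\<lambda>p. kernel p * ray p powr of_real a)))
      \<longlongrightarrow> Im (LBINT p:{0..}. kernel p * ray p powr of_real a)) at_top"
    by (intro tendsto_Im tendsto_integral_Icc_at_top kernel_powr_integrable)
  ultimately have "Im (LBINT p:{0..}. kernel p * ray p powr of_real a) = - sin (pi * a) * Gamma (a + 1)"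
    using tendsto_unique[OF trivial_limit_at_top_linorder] by fastforce
  \<comment> \<open>This is the reflection formula, taken at complex arguments and brought back to
    the reals.\<close>
  moreover have "rGamma (- a) = - sin (pi * a) * Gamma (a + 1) / pi"
  proof -
    have "complex_of_real (rGamma (- a) * rGamma (1 + a)) = of_real (- sin (pi * a) / pi)"
      using rGamma_reflection_complex[of "of_real (- a)"]
      by (simp flip: rGamma_complex_of_real sin_of_real)
    hence "rGamma (- a) * rGamma (1 + a) = - sin (pi * a) / pi"
      by (simp only: of_real_eq_iff)
    moreover have "rGamma (1 + a) = inverse (Gamma (a + 1))" "Gamma (a + 1) > 0"
      using a by (simp_all add: rGamma_inverse_Gamma add.commute Gamma_real_pos)
    ultimately show ?thesis by (simp add: field_simps)
  qed
  ultimately show ?thesis by (simp add: hankel_def)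
qed

section \<open>Linearity, recurrence and limits of Hankel integrals\<close>

lemma hankel_cmult: "hankel (\<lambda>s. of_real c * h s) = c * hankel h"
proof -
  have "(LBINT p:{0..}. kernel p * (of_real c * h (ray p))) = of_real c * (LBINT p:{0..}. kernel p * h (ray p))"
    unfolding set_integral_mult_right [symmetric] by (simp add: mult_ac)
  thus ?thesis by (simp add: hankel_def)
qed

lemma hankel_add:
  assumes "set_integrable lborel {0..} (\<lambda>p. kernel p * g (ray p))"
    and "set_integrable lborel {0..} (\<lambda>p. kernel p * h (ray p))"
  shows "hankel (\<lambda>s. g s + h s) = hankel g + hankel h"
  using set_integral_add(2)[OF assms] by (simp add: hankel_def distrib_left add_divide_distrib)

text \<open>Integration by parts: exp(s) s^a tends to 0 at infinity and is real at the starting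
  point \<open>R\<close>, so the integral of its derivative has imaginary part 0.\<close>

lemma hankel_powr_rec: "hankel (\<lambda>s. s powr of_real a) = - a * hankel (\<lambda>s. s powr of_real (a - 1))"
proof -
  let ?g = "\<lambda>s::complex. s powr of_real a" and ?h = "\<lambda>s::complex. of_real a * s powr of_real (a - 1)"
  define F where "F = (\<lambda>p. exp (ray p) * ray p powr of_real a)"
  have int: "set_integrable lborel {0..} (\<lambda>p. kernel p * ?g (ray p))"
    "set_integrable lborel {0..} (\<lambda>p. kernel p * ?h (ray p))"
    using kernel_powr_integrable[of a]
      set_integrable_mult_right[of "of_real a", OF kernel_powr_integrable[of "a - 1"]]
    by (simp_all add: mult_ac)
  have "(LBINT p:{0..}. kernel p * (?g (ray p) + ?h (ray p))) = 0 - F 0"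
  proof (rule set_integral_FTC_at_top)
    show "set_integrable lborel {0..} (\<lambda>p. kernel p * (?g (ray p) + ?h (ray p)))"
      unfolding distrib_left by (intro set_integral_add int)
    have "norm (F p) = norm (kernel p) * norm (ray p) powr a" for p
      by (simp add: F_def kernel_def norm_mult norm_ray_powr)
    thus "(F \<longlongrightarrow> 0) at_top"
      using kernel_decay[of a] by (intro tendsto_norm_zero_cancel[of F]) simp
    show "(F has_vector_derivative kernel p * (?g (ray p) + ?h (ray p))) (at p within {0..})"
      if "0 \<le> p" for p
    proof -
      have eq: "exp (ray p) * (?g (ray p) + ?h (ray p))
          = exp (ray p) * ray p powr of_real a + of_real a * ray p powr (of_real a - 1) * exp (ray p)"
        by (simp add: distrib_left)
      have "((\<lambda>s. exp s * s powr of_real a) has_field_derivative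
          exp (ray p) * (?g (ray p) + ?h (ray p))) (at (ray p))"
        unfolding eq by (rule DERIV_mult[OF DERIV_exp has_field_derivative_powr[OF ray_not_nonpos[OF that]]])
      hence "((\<lambda>s. exp s * s powr of_real a) has_field_derivative
          exp (ray p) * (?g (ray p) + ?h (ray p))) (at (ray p) within ray ` {0..})"
        by (rule has_field_derivative_at_within)
      hence "((\<lambda>s. exp s * s powr of_real a) \<circ> ray has_vector_derivative
          cis \<theta> * (exp (ray p) * (?g (ray p) + ?h (ray p)))) (at p within {0..})"
        by (rule field_vector_diff_chain_within[OF ray_has_vector_derivative])
      thus ?thesis unfolding F_def o_def kernel_def mult.assoc .
    qed
  qed
  moreover have "Im (F 0) = 0"
    using R_pos by (simp add: F_def powr_of_real Im_exp)
  ultimately have "hankel (\<lambda>s. ?g s + ?h s) = 0"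
    by (simp add: hankel_def)
  thus ?thesis
    using hankel_add[of ?g ?h, OF int] hankel_cmult[of a "\<lambda>s. s powr of_real (a - 1)"] by simp
qed

text \<open>Dominated convergence, with a growth of the exponent slower than linear so that the
  kernel still makes the majorant integrable.\<close>

lemma hankel_tendsto:
  assumes "0 < \<nu>" "\<nu> < 1"
    and "\<And>n. continuous_on {0..} (\<lambda>p. h n (ray p))" "continuous_on {0..} (\<lambda>p. g (ray p))"
    and "\<And>p. 0 \<le> p \<Longrightarrow> (\<lambda>n. h n (ray p)) \<longlonglongrightarrow> g (ray p)"
    and "\<And>n p. 0 \<le> p \<Longrightarrow> norm (h n (ray p)) \<le> B * (norm (ray p) powr a * exp (y * norm (ray p) powr \<nu>))"
  shows "(\<lambda>n. hankel (h n)) \<longlonglongrightarrow> hankel g"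
proof -
  let ?w = "\<lambda>p. of_real (B * (norm (ray p) powr a * exp (y * norm (ray p) powr \<nu>))) :: complex"
  have meas: "(\<lambda>p. indicator {0..} p *\<^sub>R (kernel p * f (ray p))) \<in> borel_measurable lborel"
    if "continuous_on {0..} (\<lambda>p. f (ray p))" for f
    using borel_measurable_continuous_on_indicator[of "{0::real..}" "\<lambda>p. kernel p * f (ray p)"]
      continuous_on_mult[OF continuous_kernel that] by simp
  \<comment> \<open>The assumed bound at \<open>p = 0\<close> forces this, since the other factor is
    positive.\<close>
  have "B \<ge> 0"
  proof (rule ccontr)
    assume "\<not> B \<ge> 0"
    hence "B * (norm (ray 0) powr a * exp (y * norm (ray 0) powr \<nu>)) < 0"
      using norm_ray_ge_1[of 0] by (intro mult_neg_pos) auto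
    with order.trans[OF norm_ge_zero assms(6)[of 0 0]] show False by simp
  qed
  have "continuous_on {0..} ?w"
    by (intro continuous_intros) auto
  hence "set_integrable lborel {0..} (\<lambda>p. kernel p * ?w p)"
    by (rule kernel_integrable[OF assms(1,2)]) (use \<open>B \<ge> 0\<close> in \<open>auto simp: norm_mult\<close>)
  hence "integrable lborel (\<lambda>p. norm (indicator {0..} p *\<^sub>R (kernel p * ?w p)))"
    unfolding set_integrable_def by (rule integrable_norm)
  hence "(\<lambda>n. LBINT p:{0..}. kernel p * h n (ray p)) \<longlonglongrightarrow> (LBINT p:{0..}. kernel p * g (ray p))"
    unfolding set_lebesgue_integral_def
  proof (intro integral_dominated_convergence[where
        w = "\<lambda>p. norm (indicator {0..} p *\<^sub>R (kernel p * ?w p))"] meas assms AE_I2)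
    show "(\<lambda>n. indicator {0..} p *\<^sub>R (kernel p * h n (ray p)))
        \<longlonglongrightarrow> indicator {0..} p *\<^sub>R (kernel p * g (ray p))" for p
      by (cases "0 \<le> p") (simp_all add: tendsto_mult[OF tendsto_const assms(5)])
    show "norm (indicator {0..} p *\<^sub>R (kernel p * h n (ray p)))
        \<le> norm (indicator {0..} p *\<^sub>R (kernel p * ?w p))" for n p
      using assms(6)[of p n] \<open>B \<ge> 0\<close>
      by (auto simp: indicator_def norm_mult intro!: mult_left_mono)
  qed
  hence "(\<lambda>n. Im (LBINT p:{0..}. kernel p * h n (ray p)) / pi)
      \<longlonglongrightarrow> Im (LBINT p:{0..}. kernel p * g (ray p)) / pi"
    by (intro tendsto_intros) auto
  thus ?thesis by (simp add: hankel_def)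
qed

lemma hankel_sum:
  assumes "\<And>j. j \<in> J \<Longrightarrow> set_integrable lborel {0..} (\<lambda>p. kernel p * h j (ray p))"
  shows "hankel (\<lambda>s. \<Sum>j\<in>J. h j s) = (\<Sum>j\<in>J. hankel (h j))"
proof -
  have "(LBINT p:{0..}. kernel p * (\<Sum>j\<in>J. h j (ray p))) = (\<Sum>j\<in>J. LBINT p:{0..}. kernel p * h j (ray p))"
    using assms unfolding set_lebesgue_integral_def set_integrable_def
    by (simp add: sum_distrib_left scaleR_sum_right)
  thus ?thesis by (simp add: hankel_def sum_divide_distrib)
qed

text \<open>One bound on the sums of norms both makes each term integrable and dominates all partial
  sums.\<close>

lemma hankel_sums:
  assumes "0 < \<nu>" "\<nu> < 1"
    and "\<And>j. continuous_on {0..} (\<lambda>p. h j (ray p))" "continuous_on {0..} (\<lambda>p. g (ray p))"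
    and "\<And>p. 0 \<le> p \<Longrightarrow> (\<lambda>j. h j (ray p)) sums g (ray p)"
    and bound: "\<And>n p. 0 \<le> p \<Longrightarrow>
      (\<Sum>j<n. norm (h j (ray p))) \<le> B * (norm (ray p) powr a * exp (y * norm (ray p) powr \<nu>))"
  shows "(\<lambda>j. hankel (h j)) sums hankel g"
proof -
  have "norm (h j (ray p)) \<le> B * (norm (ray p) powr a * exp (y * norm (ray p) powr \<nu>))"
    if "0 \<le> p" for j p
    by (rule order.trans[OF _ bound[OF that, of "Suc j"]]) (simp add: sum_nonneg)
  hence int: "set_integrable lborel {0..} (\<lambda>p. kernel p * h j (ray p))" for j
    by (intro kernel_integrable[OF assms(1,2)] assms)
  have "(\<lambda>n. hankel (\<lambda>s. \<Sum>j<n. h j s)) \<longlonglongrightarrow> hankel g"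
  proof (rule hankel_tendsto[OF assms(1,2) _ assms(4)])
    show "continuous_on {0..} (\<lambda>p. \<Sum>j<n. h j (ray p))" for n
      by (intro continuous_on_sum assms)
    show "(\<lambda>n. \<Sum>j<n. h j (ray p)) \<longlonglongrightarrow> g (ray p)" if "0 \<le> p" for p
      using assms(5)[OF that] by (simp add: sums_def)
    show "norm (\<Sum>j<n. h j (ray p)) \<le> B * (norm (ray p) powr a * exp (y * norm (ray p) powr \<nu>))"
      if "0 \<le> p" for n p
      by (rule order.trans[OF norm_sum bound[OF that]])
  qed
  thus ?thesis by (simp add: sums_def hankel_sum int)
qed

text \<open>The recurrence carries the formula from \<open>z < 0\<close> to all non-integers (at \<open>z = 0\<close> it degenerates);
  the integers follow by continuity in \<open>z\<close>.\<close>

theorem hankel_powr: "hankel (\<lambda>s. s powr of_real (- z)) = rGamma z"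
proof -
  have nonint: "hankel (\<lambda>s. s powr of_real (- z)) = rGamma z" if "z < real n" "z \<notin> \<int>" for n z
    using that
  proof (induction n arbitrary: z)
    case 0
    thus ?case using hankel_powr_pos[of "- z"] by simp
  next
    case (Suc n)
    have "z - 1 \<notin> \<int>" using Suc.prems(2) Ints_add[of "z - 1" 1] by auto
    hence "hankel (\<lambda>s. s powr of_real (- (z - 1))) = rGamma (z - 1)"
      using Suc.prems(1) by (intro Suc.IH) auto
    moreover have "hankel (\<lambda>s. s powr of_real (- (z - 1))) = (z - 1) * hankel (\<lambda>s. s powr of_real (- z))"
      using hankel_powr_rec[of "- (z - 1)"] by simp
    moreover have "rGamma (z - 1) = (z - 1) * rGamma z"
      using rGamma_plus1[of "z - 1"] by simp
    \<comment> \<open>The common factor \<open>z - 1\<close> cancels because \<open>z\<close> is not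
      an integer.\<close>
    ultimately show ?case using Suc.prems(2) by auto
  qed
  show ?thesis
  proof (cases "z \<in> \<int>")
    case False
    moreover obtain n where "z < real n" using reals_Archimedean2 by blast
    ultimately show ?thesis by (intro nonint)
  next
    case True
    \<comment> \<open>The offset lies strictly between 0 and 1 also for \<open>n = 0\<close>, so
      \<open>u n\<close> is not an integer. Approaching from above lets the power \<open>- z\<close>
      dominate, as moduli on the ray are at least 1.\<close>
    define u where "u n = z + 1 / (real n + 2)" for n
    have u: "u \<longlonglongrightarrow> z" unfolding u_def by real_asymp
    have "u n \<notin> \<int>" for n
    proof
      assume "u n \<in> \<int>"
      hence "u n - z \<in> \<int>" using True by (rule Ints_diff)
      then obtain k where k: "1 / (real n + 2) = of_int k"
        by (auto simp: u_def elim!: Ints_cases)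
      have "0 < 1 / (real n + 2)" "1 / (real n + 2) < 1" by auto
      thus False unfolding k by simp
    qed
    hence "hankel (\<lambda>s. s powr of_real (- u n)) = rGamma (u n)" for n
      using nonint reals_Archimedean2 by blast
    moreover have "(\<lambda>n. hankel (\<lambda>s. s powr of_real (- u n))) \<longlonglongrightarrow> hankel (\<lambda>s. s powr of_real (- z))"
    proof (rule hankel_tendsto)
      show "(\<lambda>n. ray p powr of_real (- u n)) \<longlonglongrightarrow> ray p powr of_real (- z)"
        if "0 \<le> p" for p
        using ray_not_nonpos[OF that] by (intro tendsto_powr_complex tendsto_intros u) auto
      show "norm (ray p powr of_real (- u n))
          \<le> 1 * (norm (ray p) powr (- z) * exp (0 * norm (ray p) powr (1 / 2)))" for n p
        using norm_ray_ge_1[of p] by (simp only: norm_ray_powr) (auto simp: u_def intro!: powr_mono)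
      show "continuous_on {0..} (\<lambda>p. ray p powr of_real (- u n))"
        "continuous_on {0..} (\<lambda>p. ray p powr of_real (- z))" for n
        by (rule continuous_ray_powr)+
    qed simp_all
    moreover have "(\<lambda>n. rGamma (u n)) \<longlonglongrightarrow> rGamma z"
      by (intro isCont_tendsto_compose[OF _ u] continuous_intros)
    ultimately show ?thesis using LIMSEQ_unique[of "\<lambda>n. rGamma (u n)"] by simp
  qed
qed

section \<open>Wright and Mittag-Leffler series under the Hankel integral\<close>

lemma ray_powr_mult_nat: "ray p powr of_real (a + b * real k) = ray p powr of_real a * (ray p powr of_real b) ^ k"
  by (simp add: powr_def exp_of_nat_mult [symmetric] exp_add [symmetric] algebra_simps)

text \<open>Each reciprocal Gamma value is the Hankel integral of s^(\<nu> - 1 + \<nu> j); under the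
  integral the series in \<open>j\<close> is that of the exponential.\<close>

lemma wright_sums_hankel:
  assumes \<nu>: "0 < \<nu>" "\<nu> < 1" and y: "0 \<le> y"
  shows "(\<lambda>j. (- y) ^ j / fact j * rGamma (- \<nu> * real j + (1 - \<nu>))) sums
    hankel (\<lambda>s. s powr of_real (\<nu> - 1) * exp (- of_real y * s powr of_real \<nu>))"
proof -
  let ?h = "\<lambda>j s. of_real ((- y) ^ j / fact j) * s powr of_real (\<nu> - 1 + \<nu> * real j) :: complex"
  have h: "?h j (ray p) = ray p powr of_real (\<nu> - 1) * ((- of_real y * ray p powr of_real \<nu>) ^ j / fact j)" for j p
    unfolding ray_powr_mult_nat power_mult_distrib by simp
  have "(\<lambda>j. hankel (?h j)) sums hankel (\<lambda>s. s powr of_real (\<nu> - 1) * exp (- of_real y * s powr of_real \<nu>))"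
  proof (rule hankel_sums[OF \<nu>])
    show "continuous_on {0..} (\<lambda>p. ?h j (ray p))" for j
      by (intro continuous_on_mult continuous_on_const continuous_ray_powr)
    show "continuous_on {0..} (\<lambda>p. ray p powr of_real (\<nu> - 1) * exp (- of_real y * ray p powr of_real \<nu>))"
      by (intro continuous_on_mult continuous_on_const continuous_ray_powr continuous_on_exp)
    show "(\<lambda>j. ?h j (ray p)) sums (ray p powr of_real (\<nu> - 1) * exp (- of_real y * ray p powr of_real \<nu>))" for p
    proof -
      have "(\<lambda>j. (- of_real y * ray p powr of_real \<nu>) ^ j / fact j) sums exp (- of_real y * ray p powr of_real \<nu>)"
        using exp_converges[of "- of_real y * ray p powr of_real \<nu>"] by (simp add: scaleR_conv_of_real field_simps)
      thus ?thesis unfolding h by (rule sums_mult)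
    qed
    show "(\<Sum>j<n. norm (?h j (ray p)))
        \<le> 1 * (norm (ray p) powr (\<nu> - 1) * exp (y * norm (ray p) powr \<nu>))" for n p
    proof -
      have "norm (?h j (ray p)) = norm (ray p) powr (\<nu> - 1) * ((y * norm (ray p) powr \<nu>) ^ j / fact j)" for j
        unfolding h using y
        by (simp add: norm_mult norm_divide norm_power norm_ray_powr del: of_real_diff)
      hence "(\<Sum>j<n. norm (?h j (ray p)))
          = norm (ray p) powr (\<nu> - 1) * (\<Sum>j<n. (y * norm (ray p) powr \<nu>) ^ j / fact j)"
        by (simp only: sum_distrib_left)
      thus ?thesis
        using sum_exp_series_le[of "y * norm (ray p) powr \<nu>" n] y by (simp add: mult_left_mono)
    qed
  qed
  moreover have "hankel (?h j) = (- y) ^ j / fact j * rGamma (- \<nu> * real j + (1 - \<nu>))" for j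
    using hankel_powr[of "- \<nu> * real j + (1 - \<nu>)"] unfolding hankel_cmult by (simp add: algebra_simps)
  ultimately show ?thesis by (simp only:)
qed

text \<open>The quotient equals s^(-1) times the geometric series of ratio - l s^(-\<nu>), and each
  term s^(-1 - \<nu> k) has Hankel integral \<open>rGamma (\<nu> * real k + 1)\<close>.\<close>

lemma mittag_leffler_sums_hankel:
  assumes \<nu>: "0 < \<nu>" "\<nu> < 1" and l: "0 \<le> l" "l < (R * sin \<theta>) powr \<nu>"
  shows "(\<lambda>k. rGamma (\<nu> * real k + 1) * (- l) ^ k) sums
    hankel (\<lambda>s. s powr of_real (\<nu> - 1) / (s powr of_real \<nu> + of_real l))"
proof -
  let ?h = "\<lambda>k s. of_real ((- l) ^ k) * s powr of_real (- 1 + - \<nu> * real k) :: complex"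
  \<comment> \<open>\<open>q\<close> bounds the modulus of the ratio on the whole ray, by
    \<open>norm_ray_ge\<close>.\<close>
  define q where "q = l * (R * sin \<theta>) powr (- \<nu>)"
  have "0 < (R * sin \<theta>) powr \<nu>" using R_pos sin_pos by simp
  hence q: "0 \<le> q" "q < 1"
    using l by (simp_all add: q_def powr_minus flip: divide_inverse)
  have h: "?h k (ray p) = ray p powr of_real (- 1) * (- of_real l * ray p powr of_real (- \<nu>)) ^ k" for k p
    unfolding ray_powr_mult_nat power_mult_distrib by simp
  have le_q: "norm (- of_real l * ray p powr of_real (- \<nu>)) \<le> q" for p
    using l \<nu> R norm_ray_ge[of p] unfolding q_def norm_mult norm_ray_powr
    by (auto intro!: mult_left_mono powr_mono2')
  have g: "ray p powr of_real (\<nu> - 1) / (ray p powr of_real \<nu> + of_real l)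
      = ray p powr of_real (- 1) * (1 / (1 - - of_real l * ray p powr of_real (- \<nu>)))" for p
  proof -
    have "ray p powr of_real (\<nu> - 1) = ray p powr of_real (- 1) * ray p powr of_real \<nu>"
      by (simp flip: powr_add)
    moreover have "ray p powr of_real \<nu> * ray p powr of_real (- \<nu>) = 1"
      by (simp flip: powr_add)
    moreover have "ray p powr of_real \<nu> \<noteq> 0" by simp
    ultimately have "ray p powr of_real \<nu> + of_real l
        = ray p powr of_real \<nu> * (1 - - of_real l * ray p powr of_real (- \<nu>))"
      by (simp add: algebra_simps)
    thus ?thesis
      unfolding \<open>ray p powr of_real (\<nu> - 1) = _\<close> using \<open>ray p powr of_real \<nu> \<noteq> 0\<close> by simp
  qed
  have "(\<lambda>k. hankel (?h k)) sums hankel (\<lambda>s. s powr of_real (\<nu> - 1) / (s powr of_real \<nu> + of_real l))"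
  proof (rule hankel_sums[OF \<nu>])
    show cont: "continuous_on {0..} (\<lambda>p. ?h k (ray p))" for k
      by (intro continuous_on_mult continuous_on_const continuous_ray_powr)
    show "continuous_on {0..} (\<lambda>p. ray p powr of_real (\<nu> - 1) / (ray p powr of_real \<nu> + of_real l))"
      unfolding g
    proof (intro continuous_on_mult continuous_on_divide continuous_on_diff continuous_on_const continuous_ray_powr ballI)
      show "1 - - of_real l * ray p powr of_real (- \<nu>) \<noteq> 0" for p
        using le_q[of p] q by (metis eq_iff_diff_eq_0 leD norm_one order.strict_trans1)
    qed
    show "(\<lambda>k. ?h k (ray p)) sums (ray p powr of_real (\<nu> - 1) / (ray p powr of_real \<nu> + of_real l))" for p
      unfolding g h using le_q[of p] q by (intro sums_mult geometric_sums) linarith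
    show "(\<Sum>k<n. norm (?h k (ray p)))
        \<le> 1 / (1 - q) * (norm (ray p) powr (- 1) * exp (0 * norm (ray p) powr \<nu>))" for n p
    proof -
      have "(\<Sum>k<n. norm (?h k (ray p))) \<le> (\<Sum>k<n. norm (ray p) powr (- 1) * q ^ k)"
        unfolding h norm_mult[of "ray p powr _"] norm_power norm_ray_powr
        by (intro sum_mono mult_left_mono power_mono le_q) auto
      also have "\<dots> = norm (ray p) powr (- 1) * (\<Sum>k<n. q ^ k)"
        by (simp only: sum_distrib_left)
      also have "\<dots> \<le> norm (ray p) powr (- 1) * (1 / (1 - q))"
        using q sum_le_suminf[of "\<lambda>k. q ^ k" "{..<n}"] summable_geometric[of q]
        by (intro mult_left_mono) (auto simp: suminf_geometric)
      finally show ?thesis by (simp add: mult.commute)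
    qed
  qed
  moreover have "hankel (?h k) = rGamma (\<nu> * real k + 1) * (- l) ^ k" for k
    using hankel_powr[of "\<nu> * real k + 1"] unfolding hankel_cmult by (simp add: algebra_simps)
  ultimately show ?thesis by (simp only:)
qed

text \<open>Fubini: for fixed \<open>p\<close> the integral in \<open>y\<close> is that of
  exp(-(s^\<nu> + l) y), with value 1/(s^\<nu> + l). The case \<open>l = 0\<close> is included and
  later gives the total mass of the density.\<close>

lemma laplace_hankel:
  assumes \<nu>: "0 < \<nu>" "\<nu> < 1" "\<nu> * \<theta> < pi / 2" and l: "0 \<le> l"
  defines "f \<equiv> \<lambda>y. hankel (\<lambda>s. s powr of_real (\<nu> - 1) * exp (- of_real y * s powr of_real \<nu>))"
  shows "set_integrable lborel {0..} (\<lambda>y. exp (- l * y) * f y)"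
    and "(LBINT y:{0..}. exp (- l * y) * f y)
      = hankel (\<lambda>s. s powr of_real (\<nu> - 1) / (s powr of_real \<nu> + of_real l))"
proof -
  define k where "k p = kernel p * ray p powr of_real (\<nu> - 1)" for p
  define c where "c p = ray p powr of_real \<nu> + of_real l" for p
  define F where "F = (\<lambda>(y, p). indicator {0..} y *\<^sub>R indicator {0..} p *\<^sub>R (k p * exp (- c p * of_real y)))"
  \<comment> \<open>A lower bound for \<open>Re (c p)\<close> independent of \<open>p\<close>: it
    splits the majorant into a function of \<open>y\<close> times a function of \<open>p\<close>,
    even for \<open>l = 0\<close>.\<close>
  define \<delta> where "\<delta> = cos (\<nu> * \<theta>)"
  have \<delta>: "\<delta> > 0" "Re (c p) \<ge> \<delta>" if "p \<ge> 0" for p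
    using Re_ray_powr_pos[OF that \<nu>(1,3)] l by (auto simp: \<delta>_def c_def)
  have int: "integrable (lborel \<Otimes>\<^sub>M lborel) F"
  proof (rule Bochner_Integration.integrable_bound)
    have "integrable lborel (\<lambda>y. indicator {0..} y *\<^sub>R exp (- \<delta> * y))"
      using set_integrable_exp_neg[OF \<delta>(1)[of 0]] by (simp add: set_integrable_def)
    moreover have "integrable lborel (\<lambda>p. norm (indicator {0..} p *\<^sub>R k p))"
      using kernel_powr_integrable[of "\<nu> - 1"] unfolding set_integrable_def k_def by (rule integrable_norm)
    ultimately show "integrable (lborel \<Otimes>\<^sub>M lborel)
        (\<lambda>(y, p). (indicator {0..} y *\<^sub>R exp (- \<delta> * y)) * norm (indicator {0..} p *\<^sub>R k p))"
      by (rule integrable_lborel_prod)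
    have "continuous_on ({0..} \<times> {0..}) (\<lambda>(y, p). k p * exp (- c p * of_real y))"
      unfolding k_def c_def case_prod_unfold
      by (intro continuous_on_mult continuous_on_exp continuous_on_add continuous_on_minus continuous_on_const
            continuous_on_compose2[OF continuous_kernel[of UNIV] continuous_on_snd]
            continuous_on_compose2[OF continuous_ray_powr continuous_on_snd]
            continuous_on_of_real continuous_on_fst continuous_on_id) auto
    hence "(\<lambda>z. indicator ({0..} \<times> {0..}) z *\<^sub>R (case z of (y, p) \<Rightarrow> k p * exp (- c p * of_real y)))
        \<in> borel_measurable borel"
      by (intro borel_measurable_continuous_on_indicator) (auto simp: borel_Times)
    also have "(\<lambda>z. indicator ({0..} \<times> {0..}) z *\<^sub>R (case z of (y, p) \<Rightarrow> k p * exp (- c p * of_real y))) = F"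
      by (auto simp: F_def indicator_def fun_eq_iff)
    finally show "F \<in> borel_measurable (lborel \<Otimes>\<^sub>M lborel)"
      by (simp add: lborel_prod)
    show "AE z in lborel \<Otimes>\<^sub>M lborel. norm (F z)
        \<le> norm (case z of (y, p) \<Rightarrow> (indicator {0..} y *\<^sub>R exp (- \<delta> * y)) * norm (indicator {0..} p *\<^sub>R k p))"
    proof (intro AE_I2, safe)
      fix y p :: real
      have "exp (- (Re (c p) * y)) \<le> exp (- (\<delta> * y))" if "0 \<le> y" "0 \<le> p"
        using \<delta>(2)[OF that(2)] that by (simp add: mult_right_mono)
      thus "norm (F (y, p)) \<le> norm ((indicator {0..} y *\<^sub>R exp (- \<delta> * y)) * norm (indicator {0..} p *\<^sub>R k p))"
        by (auto simp: F_def indicator_def norm_mult norm_exp_eq_Re mult.commute[of "norm (k p)"]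
              intro!: mult_right_mono)
    qed
  qed
  have inner_p: "(LBINT p. F (y, p))
      = indicator {0..} y *\<^sub>R (of_real (exp (- l * y)) *
          (LBINT p:{0..}. kernel p * (ray p powr of_real (\<nu> - 1) * exp (- of_real y * ray p powr of_real \<nu>))))" for y
  proof -
    have "F (y, p) = indicator {0..} y *\<^sub>R (of_real (exp (- l * y)) * (indicator {0..} p *\<^sub>R
        (kernel p * (ray p powr of_real (\<nu> - 1) * exp (- of_real y * ray p powr of_real \<nu>)))))" for p
      by (simp add: F_def k_def c_def ring_distribs exp_add exp_diff exp_minus exp_of_real[symmetric] field_simps
            indicator_def)
    thus ?thesis
      unfolding set_lebesgue_integral_def
      by (simp only: integral_scaleR_right integral_mult_right_zero)
  qed
  \<comment> \<open>The factor \<open>exp (- l * y)\<close> is real, so it passes through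
    \<open>Im\<close>.\<close>
  have Im_inner_p: "Im (LBINT p. F (y, p)) / pi = indicator {0..} y *\<^sub>R (exp (- l * y) * f y)" for y
    unfolding inner_p f_def hankel_def by simp
  have "integrable lborel (\<lambda>y. Im (LBINT p. F (y, p)) / pi)"
    using lborel_pair.integrable_fst'[OF int] by (intro integrable_divide integrable_Im) simp
  thus "set_integrable lborel {0..} (\<lambda>y. exp (- l * y) * f y)"
    unfolding Im_inner_p set_integrable_def .
  have inner_y: "(LBINT y. F (y, p))
      = indicator {0..} p *\<^sub>R (kernel p * (ray p powr of_real (\<nu> - 1) / (ray p powr of_real \<nu> + of_real l)))" for p
  proof (cases "p \<ge> 0")
    case True
    hence "0 < Re (c p)" using \<delta>[OF True] by linarith
    have "F (y, p) = indicator {0..} y *\<^sub>R (k p * exp (- c p * of_real y))" for y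
      using True by (simp add: F_def)
    hence "(LBINT y. F (y, p)) = (LBINT y:{0..}. k p * exp (- c p * of_real y))"
      by (simp only: set_lebesgue_integral_def)
    also have "\<dots> = k p * (1 / c p)"
      by (simp only: set_integral_mult_right laplace_one_complex(2)[OF \<open>0 < Re (c p)\<close>])
    finally show ?thesis using True by (simp add: k_def c_def)
  qed (simp add: F_def)
  have "(LBINT y. Im (LBINT p. F (y, p)) / pi) = Im (LBINT y. LBINT p. F (y, p)) / pi"
    using lborel_pair.integrable_fst'[OF int] by simp
  also have "(LBINT y. LBINT p. F (y, p)) = (LBINT p. LBINT y. F (y, p))"
    using lborel_pair.Fubini_integral[of "\<lambda>y p. F (y, p)"] int by simp
  finally show "(LBINT y:{0..}. exp (- l * y) * f y)
      = hankel (\<lambda>s. s powr of_real (\<nu> - 1) / (s powr of_real \<nu> + of_real l))"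
    unfolding Im_inner_p inner_y by (simp add: hankel_def set_lebesgue_integral_def)
qed

end

section \<open>The Mittag-Leffler function\<close>

definition mittag_leffler :: "real \<Rightarrow> real \<Rightarrow> real" where
  "mittag_leffler \<nu> x = (\<Sum>k. rGamma (\<nu> * real k + 1) * x ^ k)"

lemma exists_hankel_ray:
  assumes "0 < \<nu>" "\<nu> < (1::real)"
  obtains R \<theta> where "hankel_ray R \<theta>" "\<nu> * \<theta> < pi / 2" "l < (R * sin \<theta>) powr \<nu>"
proof -
  \<comment> \<open>For \<open>\<nu> < 1\<close> this lies strictly between pi/2 and both pi and
    pi/(2 \<nu>).\<close>
  define \<theta> where "\<theta> = pi / (1 + \<nu>)"
  have \<theta>: "pi / 2 < \<theta>" "\<theta> < pi" "\<nu> * \<theta> < pi / 2"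
    using assms by (auto simp: \<theta>_def field_simps)
  have "sin \<theta> > 0" using \<theta> by (intro sin_gt_zero) auto
  \<comment> \<open>\<open>b\<close> is the intended value of \<open>R * sin \<theta>\<close>: at
    least 1, and with \<open>b powr \<nu> > l\<close>.\<close>
  define b where "b = 1 + (\<bar>l\<bar> + 1) powr (1 / \<nu>)"
  have "\<bar>l\<bar> + 1 = ((\<bar>l\<bar> + 1) powr (1 / \<nu>)) powr \<nu>"
    using assms by (simp add: powr_powr)
  also have "\<dots> \<le> b powr \<nu>"
    using assms by (intro powr_mono2) (auto simp: b_def)
  finally have "l < b powr \<nu>" by linarith
  moreover have "1 \<le> b" by (simp add: b_def)
  ultimately show ?thesis
    using \<theta> \<open>sin \<theta> > 0\<close> by (intro that[of "b / sin \<theta>" \<theta>]) (auto simp: hankel_ray_def)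
qed

context
  fixes \<nu> :: real
  assumes \<nu>: "0 < \<nu>" "\<nu> < 1"
begin

text \<open>The Hankel representation, on a ray adapted to \<open>\<bar>x\<bar> + 1\<close>, gives
  convergence at a point of larger modulus than \<open>x\<close>.\<close>

lemma summable_mittag_leffler: "summable (\<lambda>k. rGamma (\<nu> * real k + 1) * x ^ k)"
proof -
  obtain R \<theta> where "hankel_ray R \<theta>" and l: "\<bar>x\<bar> + 1 < (R * sin \<theta>) powr \<nu>"
    using exists_hankel_ray[OF \<nu>] by blast
  then interpret hankel_ray R \<theta> by simp
  have "summable (\<lambda>k. rGamma (\<nu> * real k + 1) * (- (\<bar>x\<bar> + 1)) ^ k)"
    using mittag_leffler_sums_hankel[OF \<nu> _ l] by (auto simp: sums_iff)
  thus ?thesis by (rule powser_inside) auto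
qed

lemma mittag_leffler_0 [simp]: "mittag_leffler \<nu> 0 = 1"
  unfolding mittag_leffler_def by (subst powser_zero) (simp add: rGamma_inverse_Gamma)

text \<open>The ray is chosen for the given \<open>l\<close>. Neither side of the identity depends
  on the ray, so every \<open>l \<ge> 0\<close> is covered.\<close>

lemma laplace_wright:
  assumes l: "0 \<le> l"
  shows "set_integrable lborel {0..} (\<lambda>y. exp (- l * y) * wright (- \<nu>) (1 - \<nu>) (- y))"
    and "(LBINT y:{0..}. exp (- l * y) * wright (- \<nu>) (1 - \<nu>) (- y)) = mittag_leffler \<nu> (- l)"
proof -
  obtain R \<theta> where "hankel_ray R \<theta>" and ray: "\<nu> * \<theta> < pi / 2" "l < (R * sin \<theta>) powr \<nu>"
    using exists_hankel_ray[OF \<nu>] by blast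
  then interpret hankel_ray R \<theta> by simp
  let ?f = "\<lambda>y. hankel (\<lambda>s. s powr of_real (\<nu> - 1) * exp (- of_real y * s powr of_real \<nu>))"
  have f: "wright (- \<nu>) (1 - \<nu>) (- y) = ?f y" if "y \<in> {0..}" for y
    using wright_sums_hankel[OF \<nu>, of y] that by (simp add: wright_def sums_iff)
  show "set_integrable lborel {0..} (\<lambda>y. exp (- l * y) * wright (- \<nu>) (1 - \<nu>) (- y))"
    using laplace_hankel(1)[OF \<nu> ray(1) l]
    by (subst set_integrable_cong[OF refl refl, of _ _ "\<lambda>y. exp (- l * y) * ?f y"]) (auto simp: f)
  have "(LBINT y:{0..}. exp (- l * y) * wright (- \<nu>) (1 - \<nu>) (- y)) = (LBINT y:{0..}. exp (- l * y) * ?f y)"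
    by (rule set_lebesgue_integral_cong) (auto simp: f)
  also have "\<dots> = hankel (\<lambda>s. s powr of_real (\<nu> - 1) / (s powr of_real \<nu> + of_real l))"
    by (rule laplace_hankel(2)[OF \<nu> ray(1) l])
  also have "\<dots> = mittag_leffler \<nu> (- l)"
    using mittag_leffler_sums_hankel[OF \<nu> l ray(2)] by (simp add: mittag_leffler_def sums_iff)
  finally show "(LBINT y:{0..}. exp (- l * y) * wright (- \<nu>) (1 - \<nu>) (- y)) = mittag_leffler \<nu> (- l)" .
qed

text \<open>The substitution y = t^\<nu> u reduces to the Wright function, with \<open>l\<close>
  replaced by \<open>l * t powr \<nu>\<close>.\<close>

lemma laplace_folded_diffusion_density:
  assumes t: "0 < t" and l: "0 \<le> l"
  shows "integrable lborel (\<lambda>y. exp (- l * y) * folded_diffusion_density \<nu> y t)"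
    and "(LBINT y. exp (- l * y) * folded_diffusion_density \<nu> y t) = mittag_leffler \<nu> (- l * t powr \<nu>)"
proof -
  define a where "a = t powr \<nu>"
  have a: "0 < a" using t by (simp add: a_def)
  define h where "h u = indicator {0..} u *\<^sub>R (exp (- (l * a) * u) * wright (- \<nu>) (1 - \<nu>) (- u))" for u
  have la: "0 \<le> l * a" using a l by simp
  have h: "integrable lborel h" "(LBINT u. h u) = mittag_leffler \<nu> (- (l * a))"
    using laplace_wright[OF la] by (simp_all add: set_integrable_def set_lebesgue_integral_def h_def[abs_def])
  have eq: "exp (- l * y) * folded_diffusion_density \<nu> y t = (1 / a) * h (0 + (1 / a) * y)" for y
    using a by (auto simp: folded_diffusion_density_def h_def indicator_def zero_le_divide_iff simp flip: a_def)
  show "integrable lborel (\<lambda>y. exp (- l * y) * folded_diffusion_density \<nu> y t)"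
    unfolding eq using a by (intro integrable_mult_right lborel_integrable_real_affine h) auto
  show "(LBINT y. exp (- l * y) * folded_diffusion_density \<nu> y t) = mittag_leffler \<nu> (- l * t powr \<nu>)"
    unfolding eq using lborel_integral_real_affine[of "1 / a" h 0] a h
    by (simp add: a_def)
qed

section \<open>Derivative and fractional relaxation equation\<close>

lemma diffs_mittag_leffler:
  "diffs (\<lambda>k. rGamma (\<nu> * real k + 1)) n = rGamma (\<nu> * real (Suc n)) / \<nu>"
  \<comment> \<open>The factor \<open>Suc n\<close> from differentiation is absorbed by
    \<open>z * rGamma (z + 1) = rGamma z\<close>, which leaves 1/\<nu>.\<close>
  using rGamma_plus1[of "\<nu> * real (Suc n)"] \<nu> by (simp add: diffs_def field_simps)

lemma mittag_leffler_has_derivative: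
  "(mittag_leffler \<nu> has_field_derivative (\<Sum>n. rGamma (\<nu> * real (Suc n)) / \<nu> * x ^ n)) (at x)"
  using termdiffs_strong_converges_everywhere[OF summable_mittag_leffler, of x]
  by (simp only: diffs_mittag_leffler mittag_leffler_def[abs_def])

lemma summable_mittag_leffler_deriv: "summable (\<lambda>n. rGamma (\<nu> * real (Suc n)) * x ^ n)"
proof -
  have "summable (\<lambda>n. rGamma (\<nu> * real (Suc n)) / \<nu> * x ^ n)"
    using termdiff_converges_all[OF summable_mittag_leffler, of x] by (simp only: diffs_mittag_leffler)
  from summable_mult[OF this, of \<nu>] show ?thesis using \<nu> by (simp add: mult_ac)
qed

text \<open>The substitution s = t x turns it into the Beta integral on the unit interval; the
  Jacobian contributes one of the powers of \<open>t\<close>.\<close>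

lemma beta_integral_interval:
  assumes "0 < a" "0 < b" "0 < (t::real)"
  shows "set_integrable lborel {0<..<t} (\<lambda>s. s powr (a - 1) * (t - s) powr (b - 1))"
    and "(LBINT s:{0<..<t}. s powr (a - 1) * (t - s) powr (b - 1)) = t powr (a + b - 1) * Beta a b"
proof -
  define h where "h x = indicator {0..1} x *\<^sub>R (x powr (a - 1) * (1 - x) powr (b - 1))" for x :: real
  have int: "set_integrable lborel {0..1} (\<lambda>x::real. x powr (a - 1) * (1 - x) powr (b - 1))"
    by (rule integrable_Beta[OF assms(1,2)])
  have h: "integrable lborel h" using int by (simp add: set_integrable_def h_def[abs_def])
  have "(LBINT x:{0..1}. x powr (a - 1) * (1 - x) powr (b - 1)) = Beta a b"
    using set_borel_integral_eq_integral(2)[OF int] has_integral_Beta_real[OF assms(1,2)]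
    by (simp add: integral_unique)
  hence hB: "(LBINT x. h x) = Beta a b" by (simp add: h_def[abs_def] set_lebesgue_integral_def)
  have eq: "indicator {0<..<t} s *\<^sub>R (s powr (a - 1) * (t - s) powr (b - 1))
      = t powr (a + b - 2) * h (0 + (1 / t) * s)" for s
  proof (cases "s \<in> {0<..<t}")
    case True
    hence "1 - s / t = (t - s) / t" using assms by (simp add: field_simps)
    hence "h (0 + (1 / t) * s) = (s / t) powr (a - 1) * ((t - s) / t) powr (b - 1)"
      using True by (simp add: h_def)
    also have "\<dots> = s powr (a - 1) * (t - s) powr (b - 1) / (t powr (a - 1) * t powr (b - 1))"
      using True by (simp add: powr_divide)
    also have "t powr (a - 1) * t powr (b - 1) = t powr (a + b - 2)"
      by (simp flip: powr_add)
    finally show ?thesis using True assms by simp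
  next
    case False
    \<comment> \<open>At the endpoints \<open>h\<close> vanishes since \<open>0 powr c = 0\<close>,
      so the closed and the open interval agree pointwise.\<close>
    thus ?thesis using assms by (auto simp: h_def indicator_def field_simps)
  qed
  show "set_integrable lborel {0<..<t} (\<lambda>s. s powr (a - 1) * (t - s) powr (b - 1))"
    unfolding set_integrable_def eq using assms
    by (intro integrable_mult_right lborel_integrable_real_affine h) auto
  have "(LBINT s. h (0 + (1 / t) * s)) = t * Beta a b"
    using lborel_integral_real_affine[of "1 / t" h 0] assms hB by (simp add: field_simps)
  thus "(LBINT s:{0<..<t}. s powr (a - 1) * (t - s) powr (b - 1)) = t powr (a + b - 1) * Beta a b"
    unfolding set_lebesgue_integral_def eq using assms powr_add[of t "a + b - 2" 1] by simp
qed

text \<open>The derivative of \<open>u\<close> is a series in s^(\<nu> (n + 1) - 1). Integrating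
  each term against (t - s)^(-\<nu>) gives a Beta value whose factor
  \<open>Gamma (\<nu> * real (Suc n))\<close> cancels the coefficient, and the Mittag-Leffler series
  returns with factor \<open>- l\<close>.\<close>

lemma caputo_mittag_leffler:
  assumes t: "0 < t" and l: "0 < l"
    and u: "\<And>s. 0 < s \<Longrightarrow> u s = mittag_leffler \<nu> (- l * s powr \<nu>)"
  shows "has_caputo_deriv \<nu> u (- l * u t) t"
proof -
  have du: "(u has_field_derivative
      (\<Sum>n. rGamma (\<nu> * real (Suc n)) / \<nu> * (- l * s powr \<nu>) ^ n) * (- l * (\<nu> * s powr (\<nu> - 1)))) (at s)"
    if s: "0 < s" for s
  \<comment> \<open>\<open>u\<close> is known only at positive arguments, so the derivative is
    transferred on the open half-line.\<close>
  proof (rule has_field_derivative_transform_within_open[of _ _ _ "{0<..}"])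
    have "((\<lambda>s. - l * s powr \<nu>) has_field_derivative (- l * (\<nu> * s powr (\<nu> - 1)))) (at s)"
      using s by (intro DERIV_cmult has_real_derivative_powr)
    from DERIV_chain2[OF mittag_leffler_has_derivative this]
    show "((\<lambda>s. mittag_leffler \<nu> (- l * s powr \<nu>)) has_field_derivative
      (\<Sum>n. rGamma (\<nu> * real (Suc n)) / \<nu> * (- l * s powr \<nu>) ^ n) * (- l * (\<nu> * s powr (\<nu> - 1)))) (at s)" .
  qed (use s u in auto)
  let ?c = "\<lambda>n. - l * (- l) ^ n * rGamma (\<nu> * real (Suc n))"
  \<comment> \<open>The terms of the Caputo integrand, with exponents in the shape of a Beta
    integral with parameters \<open>\<nu> * real (Suc n)\<close> and
    \<open>1 - \<nu>\<close>.\<close>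
  define g where "g n s = indicator {0<..<t} s *\<^sub>R
      (?c n * (s powr (\<nu> * real (Suc n) - 1) * (t - s) powr ((1 - \<nu>) - 1)))" for n s
  have a: "0 < \<nu> * real (Suc n)" for n using \<nu> by simp
  have g_eq: "g n s = indicator {0<..<t} s *\<^sub>R ((t - s) powr (- \<nu>) * (- l * s powr (\<nu> - 1))
      * (rGamma (\<nu> * real (Suc n)) * (- l * s powr \<nu>) ^ n))" for n s
  proof (cases "s \<in> {0<..<t}")
    case True
    have "s powr (\<nu> * real (Suc n) - 1) = s powr (\<nu> - 1 + \<nu> * real n)"
      by (simp add: algebra_simps)
    also have "\<dots> = s powr (\<nu> - 1) * (s powr \<nu>) ^ n"
      using True by (simp add: powr_add powr_power mult.commute)
    finally have "s powr (\<nu> * real (Suc n) - 1) = s powr (\<nu> - 1) * (s powr \<nu>) ^ n" .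
    moreover have "(1 - \<nu>) - 1 = - \<nu>" by simp
    ultimately show ?thesis
      unfolding g_def power_mult_distrib by (simp only: mult_ac)
  qed (simp add: g_def)
  have g_int: "integrable lborel (g n)" for n
    using set_integrable_mult_right[OF beta_integral_interval(1)[OF a, of "1 - \<nu>" t n], of "?c n"] \<nu> t
    by (simp add: set_integrable_def g_def[abs_def])
  have beta: "(LBINT s:{0<..<t}. s powr (\<nu> * real (Suc n) - 1) * (t - s) powr ((1 - \<nu>) - 1))
      = (t powr \<nu>) ^ n * (Gamma (\<nu> * real (Suc n)) * Gamma (1 - \<nu>) * rGamma (\<nu> * real n + 1))" for n
    using \<nu> t beta_integral_interval(2)[OF a, of "1 - \<nu>" t n]
    by (simp add: Beta_altdef powr_power algebra_simps)
  have G: "rGamma (\<nu> * real (Suc n)) * Gamma (\<nu> * real (Suc n)) = 1" "0 < Gamma (\<nu> * real (Suc n))" for n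
    using Gamma_real_pos[OF a[of n]] by (simp_all add: rGamma_inverse_Gamma)
  have G': "0 < Gamma (1 - \<nu>)" "0 < rGamma (\<nu> * real n + 1)" "0 < rGamma (\<nu> * real (Suc n))" for n
    using \<nu> a[of n] by (auto simp: rGamma_inverse_Gamma intro!: Gamma_real_pos add_nonneg_pos)
  have int_g: "(LBINT s. g n s) = - l * Gamma (1 - \<nu>) * (rGamma (\<nu> * real n + 1) * (- l * t powr \<nu>) ^ n)" for n
  proof -
    have "(LBINT s. g n s) = ?c n * (LBINT s:{0<..<t}. s powr (\<nu> * real (Suc n) - 1) * (t - s) powr ((1 - \<nu>) - 1))"
      unfolding set_integral_mult_right [symmetric] by (simp only: g_def set_lebesgue_integral_def)
    also have "\<dots> = - l * (- l) ^ n * (rGamma (\<nu> * real (Suc n)) * Gamma (\<nu> * real (Suc n)))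
        * (t powr \<nu>) ^ n * Gamma (1 - \<nu>) * rGamma (\<nu> * real n + 1)"
      unfolding beta by (simp only: mult_ac)
    finally show ?thesis unfolding power_mult_distrib G by (simp add: mult_ac)
  qed
  \<comment> \<open>Absolute values only change \<open>- l\<close> to \<open>l\<close>, so these
    integrals form a convergent Mittag-Leffler series; this justifies summing under the
    integral.\<close>
  have norm_g: "(LBINT s. norm (g n s)) = l * Gamma (1 - \<nu>) * (rGamma (\<nu> * real n + 1) * (l * t powr \<nu>) ^ n)" for n
  proof -
    have "norm (g n s) = indicator {0<..<t} s *\<^sub>R (\<bar>?c n\<bar> * (s powr (\<nu> * real (Suc n) - 1) * (t - s) powr ((1 - \<nu>) - 1)))" for s
      by (simp add: g_def abs_mult indicator_def)
    hence "(LBINT s. norm (g n s)) = \<bar>?c n\<bar> * (LBINT s:{0<..<t}. s powr (\<nu> * real (Suc n) - 1) * (t - s) powr ((1 - \<nu>) - 1))"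
      unfolding set_integral_mult_right [symmetric] by (simp only: set_lebesgue_integral_def)
    also have "\<bar>?c n\<bar> = l * l ^ n * rGamma (\<nu> * real (Suc n))"
      using l G'(3)[of n] by (simp add: abs_mult power_abs)
    also have "\<dots> * (LBINT s:{0<..<t}. s powr (\<nu> * real (Suc n) - 1) * (t - s) powr ((1 - \<nu>) - 1))
       = l * l ^ n * (rGamma (\<nu> * real (Suc n)) * Gamma (\<nu> * real (Suc n)))
        * (t powr \<nu>) ^ n * Gamma (1 - \<nu>) * rGamma (\<nu> * real n + 1)"
      unfolding beta by (simp only: mult_ac)
    finally show ?thesis unfolding power_mult_distrib G by (simp add: mult_ac)
  qed
  have g_summable: "summable (\<lambda>n. norm (g n s))" for s
  proof -
    have "norm (g n s) = norm (indicator {0<..<t} s *\<^sub>R ((t - s) powr (- \<nu>) * (- l * s powr (\<nu> - 1))))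
      * (rGamma (\<nu> * real (Suc n)) * (l * s powr \<nu>) ^ n)" for n
      unfolding g_eq using l G'(3)[of n] by (simp add: abs_mult power_abs)
    thus ?thesis
      by (simp only:) (intro summable_mult summable_mittag_leffler_deriv)
  qed
  have norm_summable: "summable (\<lambda>n. LBINT s. norm (g n s))"
    unfolding norm_g by (intro summable_mult summable_mittag_leffler)
  have sum_g: "(\<Sum>n. g n s) = indicator {0<..<t} s *\<^sub>R (1 / (t - s) powr \<nu> * deriv u s)" for s
  proof (cases "s \<in> {0<..<t}")
    case True
    have "deriv u s = (\<Sum>n. rGamma (\<nu> * real (Suc n)) / \<nu> * (- l * s powr \<nu>) ^ n) * (- l * (\<nu> * s powr (\<nu> - 1)))"
      using True by (intro DERIV_imp_deriv du) auto
    also have "(\<Sum>n. rGamma (\<nu> * real (Suc n)) / \<nu> * (- l * s powr \<nu>) ^ n)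
        = (\<Sum>n. rGamma (\<nu> * real (Suc n)) * (- l * s powr \<nu>) ^ n) / \<nu>"
      using suminf_divide[OF summable_mittag_leffler_deriv, of "- l * s powr \<nu>" \<nu>] by simp
    finally have "deriv u s = (- l * s powr (\<nu> - 1)) * (\<Sum>n. rGamma (\<nu> * real (Suc n)) * (- l * s powr \<nu>) ^ n)"
      using \<nu> by simp
    moreover have "(\<Sum>n. g n s) = (t - s) powr (- \<nu>) * (- l * s powr (\<nu> - 1))
        * (\<Sum>n. rGamma (\<nu> * real (Suc n)) * (- l * s powr \<nu>) ^ n)"
      unfolding g_eq using True
      by (simp only: indicator_simps scaleR_one suminf_mult[OF summable_mittag_leffler_deriv])
    ultimately show ?thesis using True by (simp add: powr_minus_divide)
  qed (simp add: g_def)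
  have "(\<lambda>n. LBINT s. g n s) sums (LBINT s:{0<..<t}. 1 / (t - s) powr \<nu> * deriv u s)"
    using sums_integral[OF g_int AE_I2[OF g_summable] norm_summable]
    by (simp add: sum_g set_lebesgue_integral_def)
  moreover have "(\<lambda>n. LBINT s. g n s) sums (- l * Gamma (1 - \<nu>) * mittag_leffler \<nu> (- l * t powr \<nu>))"
    unfolding int_g mittag_leffler_def by (intro sums_mult summable_sums summable_mittag_leffler)
  ultimately have "(LBINT s:{0<..<t}. 1 / (t - s) powr \<nu> * deriv u s) = - l * Gamma (1 - \<nu>) * u t"
    using sums_unique2 u[OF t] by metis
  hence "caputo_deriv \<nu> u t = - l * u t"
    using G'(1) by (simp add: caputo_deriv_def)
  moreover have "set_integrable lborel {0<..<t} (\<lambda>s. 1 / (t - s) powr \<nu> * deriv u s)"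
    using integrable_suminf[OF g_int AE_I2[OF g_summable] norm_summable]
    by (simp add: sum_g set_integrable_def)
  moreover have "\<forall>s\<in>{0<..<t}. u differentiable (at s)"
    unfolding real_differentiable_def by (auto intro!: exI du)
  ultimately show ?thesis by (simp add: has_caputo_deriv_def)
qed

end

section \<open>The crossing probability\<close>

context prob_space
begin

text \<open>Conditioning on the value x of \<open>X\<close> gives the tail exp(- l x) of
  \<open>U\<close>. As \<open>ennreal\<close> cuts off negative values, passing to a real integral
  rests on \<open>q\<close> being nonnegative almost everywhere.\<close>

lemma prob_less_exponential:
  fixes q :: "real \<Rightarrow> real"
  assumes X: "distributed M lborel X (\<lambda>y. ennreal (q y))"
    and U: "distributed M lborel U (\<lambda>y. ennreal (exponential_density l y))" and l: "0 < l"
    and indep: "indep_var lborel X lborel U"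
    and q: "AE y in lborel. 0 \<le> q y" "\<And>y. y < 0 \<Longrightarrow> q y = 0"
    and int: "integrable lborel (\<lambda>y. exp (- l * y) * q y)"
  shows "prob {\<omega> \<in> space M. X \<omega> < U \<omega>} = (LBINT y. exp (- l * y) * q y)"
proof -
  have [measurable]: "(\<lambda>y. ennreal (q y)) \<in> borel_measurable lborel"
    using X by (rule distributed_borel_measurable)
  let ?A = "{z \<in> space (lborel \<Otimes>\<^sub>M lborel). fst z < snd z} :: (real \<times> real) set"
  have "?A \<in> sets (lborel \<Otimes>\<^sub>M lborel)" by measurable
  from distributed_emeasure[OF distributed_joint_indep[OF lborel.sigma_finite_measure_axioms lborel.sigma_finite_measure_axioms X U indep] this]
  have "emeasure M {\<omega> \<in> space M. X \<omega> < U \<omega>}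
      = (\<integral>\<^sup>+z. (case z of (x, y) \<Rightarrow> ennreal (q x) * ennreal (exponential_density l y)) * indicator ?A z \<partial>(lborel \<Otimes>\<^sub>M lborel))"
    by (simp add: vimage_def Int_def conj_commute space_pair_measure)
  also have "\<dots> = (\<integral>\<^sup>+x. \<integral>\<^sup>+y. ennreal (q x) * ennreal (exponential_density l y) * indicator ?A (x, y) \<partial>lborel \<partial>lborel)"
    by (subst lborel.nn_integral_fst [symmetric]) auto
  also have "\<dots> = (\<integral>\<^sup>+x. ennreal (exp (- l * x) * q x) \<partial>lborel)"
  proof (rule nn_integral_cong_AE)
    show "AE x in lborel. (\<integral>\<^sup>+y. ennreal (q x) * ennreal (exponential_density l y) * indicator ?A (x, y) \<partial>lborel)
        = ennreal (exp (- l * x) * q x)"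
      using q(1)
    proof eventually_elim
      case (elim x)
      show ?case
      \<comment> \<open>The exponential tail formula needs \<open>x \<ge> 0\<close>; for negative
        \<open>x\<close> the density \<open>q\<close> vanishes.\<close>
      proof (cases "x < 0")
        case False
        have "(\<integral>\<^sup>+y. ennreal (q x) * ennreal (exponential_density l y) * indicator ?A (x, y) \<partial>lborel)
            = ennreal (q x) * (\<integral>\<^sup>+y. ennreal (exponential_density l y) * indicator {x<..} y \<partial>lborel)"
          by (subst nn_integral_cmult [symmetric])
             (auto simp: indicator_def space_pair_measure mult.assoc intro!: nn_integral_cong)
        also have "(\<integral>\<^sup>+y. ennreal (exponential_density l y) * indicator {x<..} y \<partial>lborel)
            = emeasure M (U -` {x<..} \<inter> space M)"
          by (rule distributed_emeasure[OF U, symmetric]) simp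
        also have "\<dots> = ennreal (prob {\<omega> \<in> space M. x < U \<omega>})"
          by (simp add: emeasure_eq_measure vimage_def Int_def conj_commute)
        also have "prob {\<omega> \<in> space M. x < U \<omega>} = exp (- x * l)"
          using exponential_distributedD_gt[OF U _ l] False by simp
        finally show ?thesis using elim by (simp add: ennreal_mult' mult.commute)
      qed (simp add: q)
    qed
  qed
  also have "\<dots> = ennreal (LBINT y. exp (- l * y) * q y)"
    using q(1) by (intro nn_integral_eq_integral int) auto
  finally have "emeasure M {\<omega> \<in> space M. X \<omega> < U \<omega>} = ennreal (LBINT y. exp (- l * y) * q y)" .
  moreover have "0 \<le> (LBINT y. exp (- l * y) * q y)"
    using q(1) by (intro integral_nonneg_AE) auto
  ultimately show ?thesis by (simp add: measure_def)
qed

text \<open>The coordinate \<open>T t\<close> is measurable for the sigma-algebra generated by the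
  whole process, and independence passes to smaller sigma-algebras.\<close>

lemma indep_var_of_process:
  assumes indep: "indep_set (sets (vimage_algebra (space M) (\<lambda>\<omega>. \<lambda>t\<in>I. T t \<omega>) (Pi\<^sub>M I (\<lambda>_. borel))))
      (sets (vimage_algebra (space M) U borel))"
    and t: "t \<in> I" and [measurable]: "random_variable borel (T t)" "random_variable borel U"
  shows "indep_var lborel (T t) lborel U"
proof -
  let ?V = "vimage_algebra (space M) (\<lambda>\<omega>. \<lambda>t\<in>I. T t \<omega>) (Pi\<^sub>M I (\<lambda>_. borel))"
  have "(\<lambda>\<omega>. (\<lambda>t\<in>I. T t \<omega>) t) \<in> borel_measurable ?V"
    by (rule measurable_compose[OF measurable_vimage_algebra1 measurable_component_singleton])
       (use t in \<open>auto simp: space_PiM\<close>)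
  hence T: "T t \<in> borel_measurable ?V" using t by simp
  have "sigma_sets (space M) {T t -` A \<inter> space M |A. A \<in> sets lborel} \<subseteq> sets ?V"
    using measurable_sets[OF T] by (intro sets.sigma_sets_subset[of _ ?V, simplified]) auto
  moreover have "sigma_sets (space M) {U -` A \<inter> space M |A. A \<in> sets lborel}
      \<subseteq> sets (vimage_algebra (space M) U borel)"
    by (simp add: sets_vimage_algebra)
  ultimately have "indep_set (sigma_sets (space M) {T t -` A \<inter> space M |A. A \<in> sets lborel})
      (sigma_sets (space M) {U -` A \<inter> space M |A. A \<in> sets lborel})"
    unfolding indep_set_def
    by (intro indep_sets_mono_sets[OF indep[unfolded indep_set_def]]) (simp split: bool.split)
  thus ?thesis by (simp add: indep_var_eq)
qed

end

theorem theorem2p1: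
  fixes M :: "'a measure" and U :: "'a \<Rightarrow> real" and T :: "real \<Rightarrow> 'a \<Rightarrow> real"
    and \<nu> l :: real
  assumes "prob_space M"
    and "0 < \<nu>" and "\<nu> < 1" and "l > 0"
    and "distributed M lborel U (\<lambda>y. ennreal (exponential_density l y))"
    and "\<And>t \<omega>. t > 0 \<Longrightarrow> \<omega> \<in> space M \<Longrightarrow> T t \<omega> \<ge> 0"
    and "\<And>t. t > 0 \<Longrightarrow>
           distributed M lborel (T t) (\<lambda>y. ennreal (folded_diffusion_density \<nu> y t))"
    and "prob_space.indep_set M
           (sets (vimage_algebra (space M) (\<lambda>\<omega>. \<lambda>t\<in>{0<..}. T t \<omega>) (Pi\<^sub>M {0<..} (\<lambda>_. borel))))
           (sets (vimage_algebra (space M) U borel))"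
  shows "(\<forall>t>0. has_caputo_deriv \<nu> (crossing_prob M T U) (- l * crossing_prob M T U t) t) \<and>
         (crossing_prob M T U \<longlongrightarrow> 1) (at_right 0)"
proof -
  interpret prob_space M by fact
  note \<nu> = \<open>0 < \<nu>\<close> \<open>\<nu> < 1\<close>
  note l = \<open>l > 0\<close>
  note U = assms(5)
  have \<psi>: "crossing_prob M T U t = mittag_leffler \<nu> (- l * t powr \<nu>)" if t: "0 < t" for t
  proof -
    let ?q = "\<lambda>y. folded_diffusion_density \<nu> y t"
    note X = assms(7)[OF t]
    have q: "integrable lborel ?q" "(LBINT y. ?q y) = 1"
      using laplace_folded_diffusion_density[OF \<nu> t, of 0] \<nu> by simp_all
    \<comment> \<open>The density hypothesis sees only the positive part of \<open>?q\<close>, so it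
      yields total mass 1 for that part.\<close>
    have "ennreal (max 0 x) = ennreal x" for x
      by (simp add: max_def ennreal_neg)
    hence "(\<integral>\<^sup>+y. ennreal (max 0 (?q y)) \<partial>lborel) = 1"
      using distributed_emeasure[OF X, of UNIV] by (simp add: emeasure_space_1)
    moreover have max_int: "integrable lborel (\<lambda>y. max 0 (?q y))"
      using q(1) by simp
    ultimately have "(LBINT y. max 0 (?q y)) = 1"
      by (subst (asm) nn_integral_eq_integral) auto
    \<comment> \<open>Both integrals are 1. The difference is the negative part, a nonnegative
      function that must therefore vanish almost everywhere.\<close>
    hence "(LBINT y. max 0 (?q y) - ?q y) = 0"
      using q max_int by simp
    hence "AE y in lborel. max 0 (?q y) - ?q y = 0"
      using q max_int by (subst (asm) integral_nonneg_eq_0_iff_AE) auto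
    hence nonneg: "AE y in lborel. 0 \<le> ?q y"
      by eventually_elim (simp add: max_def split: if_splits)
    have "indep_var lborel (T t) lborel U"
      using distributed_measurable[OF X] distributed_measurable[OF U] t
      by (intro indep_var_of_process[OF assms(8)]) auto
    from prob_less_exponential[OF X U l this nonneg]
    have "crossing_prob M T U t = (LBINT y. exp (- l * y) * ?q y)"
      using laplace_folded_diffusion_density(1)[OF \<nu> t, of l] l
      by (simp add: crossing_prob_def folded_diffusion_density_def)
    thus ?thesis
      using laplace_folded_diffusion_density(2)[OF \<nu> t, of l] l by simp
  qed
  \<comment> \<open>The initial value follows from continuity at 0, where the function equals
    1.\<close>
  have "isCont (mittag_leffler \<nu>) 0"
    using DERIV_isCont[OF mittag_leffler_has_derivative[OF \<nu>]] .
  moreover have "((\<lambda>t. - l * t powr \<nu>) \<longlongrightarrow> 0) (at_right 0)"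
    using \<nu> l by real_asymp
  ultimately have "((\<lambda>t. mittag_leffler \<nu> (- l * t powr \<nu>)) \<longlongrightarrow> mittag_leffler \<nu> 0) (at_right 0)"
    by (rule isCont_tendsto_compose)
  hence "((\<lambda>t. mittag_leffler \<nu> (- l * t powr \<nu>)) \<longlongrightarrow> 1) (at_right 0)"
    using \<nu> by simp
  hence "(crossing_prob M T U \<longlongrightarrow> 1) (at_right 0)"
    by (rule Lim_transform_eventually)
       (use eventually_at_right_less in \<open>eventually_elim, simp add: \<psi>\<close>)
  thus ?thesis
    using caputo_mittag_leffler[OF \<nu> _ l \<psi>] by blast
qed

end
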